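(* Let $X$ be a Hilbert space with inner product $\langle\cdot,\cdot\rangle_X$, let $A:D_X(A)\subset X\to X$ and $\hat\Lambda:D_X(\hat\Lambda)\subset X\to X$ be linear operators, let $Y=(\mathrm{Ker}\,\hat\Lambda)^\perp$ be the orthogonal complement in $X$, and let $\mathbb{Q}:X\to Y$ be the orthogonal projection. Assume: (1) $A$ is self-adjoint with compact resolvent and $\langle -Au,u\rangle_X\ge\|u\|_X^2$ for all $u\in D_X(A)$. (2)(i) $\hat\Lambda$ is densely defined, closed, and relatively compact with respect to $-A$ in $X$. (2)(ii) $\mathbb{Q}A\subset A\mathbb{Q}$, $D_X(A)\subset D_X(\hat\Lambda^* )$, and there is $C>0$ such that $|\langle\hat\Lambda u,u\rangle_X|+|\mathrm{Im}\langle -Au,\hat\Lambda u\rangle_X|\le C\langle -Au,u\rangle_X$ for all $u\in D_X(A)$. (2)(iii) There exist closed symmetric operators $B_1,B_2$ and constants $c_1,C>0$ such that $\hat\Lambda=B_1B_2$, $\mathrm{Ker}\,\hat\Lambda=\mathrm{Ker}\,B_2$, and $\|B_2u\|_X^2\le C\|(-A)^{1/2}u\|_X^2$ for $u\in D_X(A)$; $\langle u,B_2u\rangle_X\ge c_1\|u\|_X^2$ for $u\in D_X(A)\cap Y$; $\mathrm{Re}\langle -Au,B_2u\rangle_X\ge c_1\|(-A)^{1/2}u\|_X^2$ for $u\in D_X(A)\cap Y$. (3) $\mathrm{Ker}\,\hat\Lambda\subset D_X(\hat\Lambda^* )$; $\mathrm{Ker}\,\hat\Lambda\cap\mathrm{Ran}\,\hat\Lambda=\{0\}$;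 and $\hat\Lambda$ has no eigenvalue in $\mathbb{R}\setminus\{0\}$. For $\alpha\in\mathbb{R}$ let $L_\alpha=A-i\alpha\hat\Lambda$ with domain $D_X(A)$, and let $\mathbb{Q}L_\alpha$ denote the operator in $Y$ with domain $D_X(A)\cap Y$ given by $u\mapsto\mathbb{Q}Au-i\alpha\mathbb{Q}\hat\Lambda u$; let $\sigma_Y(\mathbb{Q}L_\alpha)$ be its spectrum in $Y$. Then $$\lim_{|\alpha|\to\infty}\ \sup_{\mu\in\sigma_Y(\mathbb{Q}L_\alpha)}\mathrm{Re}\,\mu=-\infty,\qquad \lim_{|\alpha|\to\infty}\ \sup_{\lambda\in\mathbb{R}}\|(i\lambda-\mathbb{Q}L_\alpha)^{-1}\|_{Y\to Y}=0.$$ Moreover, for all sufficiently large $|\alpha|$ the set $\{\zeta\in\mathbb{C}:\mathrm{Re}\,\zeta>-1\}$ is contained in the resolvent set of $L_\alpha$ in $X$, and $$\lim_{|\alpha|\to\infty}\ \sup_{\lambda\in\mathbb{R}}\|\mathbb{Q}(i\lambda-L_\alpha)^{-1}\|_{X\to X}=0.$$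
   Context: $D_X(T)$ denotes the domain of an operator $T$ in $X$, and $\hat\Lambda^*$ is the adjoint of $\hat\Lambda$ in $X$. $\mathrm{Ran}\,\hat\Lambda=\{\hat\Lambda g: g\in D_X(\hat\Lambda)\}$. $\hat\Lambda$ relatively compact with respect to $-A$ means $D_X(A)\subset D_X(\hat\Lambda)$ and $\hat\Lambda$ is compact from $D_X(A)$ (graph norm) to $X$. $\mathbb{Q}A\subset A\mathbb{Q}$ means: if $u\in D_X(A)$ then $\mathbb{Q}u\in D_X(A)$ and $A\mathbb{Q}u=\mathbb{Q}Au$. $(-A)^{1/2}$ is the square root of the positive self-adjoint operator $-A$. The inequalities involving $B_2u$ include that $D_X(A)$ is contained in the domain of $B_2$. Convention: $\sup\emptyset=-\infty$. *)

theory Defs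
  imports "HOL-Analysis.Analysis"
begin

section \<open>Complex Hilbert spaces\<close>

text \<open>
  The real inner product inherited from \<^class>\<open>real_inner\<close> is the real part of the complex
  one, so the norm and the topology are those of the complex inner product.
  The complex inner product is linear in its first argument.
\<close>

class chilbert_space = real_inner + complete_space +
  fixes scaleC :: "complex \<Rightarrow> 'a \<Rightarrow> 'a"  (infixr "*\<^sub>C" 75)
    and cinner :: "'a \<Rightarrow> 'a \<Rightarrow> complex"
  assumes scaleC_add_right: "c *\<^sub>C (x + y) = c *\<^sub>C x + c *\<^sub>C y"
    and scaleC_add_left: "(c + d) *\<^sub>C x = c *\<^sub>C x + d *\<^sub>C x"
    and scaleC_scaleC: "c *\<^sub>C (d *\<^sub>C x) = (c * d) *\<^sub>C x"
    and scaleC_of_real: "complex_of_real r *\<^sub>C x = r *\<^sub>R x"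
    and cinner_commute: "cinner x y = cnj (cinner y x)"
    and cinner_add_left: "cinner (x + y) z = cinner x z + cinner y z"
    and cinner_scaleC_left: "cinner (c *\<^sub>C x) y = c * cinner x y"
    and Re_cinner: "Re (cinner x y) = inner x y"
begin

subclass banach ..

end

instantiation complex :: chilbert_space
begin

definition scaleC_complex :: "complex \<Rightarrow> complex \<Rightarrow> complex"
  where "scaleC_complex c x = c * x"

definition cinner_complex :: "complex \<Rightarrow> complex \<Rightarrow> complex"
  where "cinner_complex x y = x * cnj y"

instance
  by standard
    (auto simp: scaleC_complex_def cinner_complex_def inner_complex_def
      algebra_simps scaleR_conv_of_real)

end

definition csubspace :: "'a::chilbert_space set \<Rightarrow> bool" where
  "csubspace V \<longleftrightarrow>
     0 \<in> V \<and> (\<forall>x\<in>V. \<forall>y\<in>V. x + y \<in> V) \<and> (\<forall>c. \<forall>x\<in>V. c *\<^sub>C x \<in> V)"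

definition orth_complement :: "'a::chilbert_space set \<Rightarrow> 'a set" where
  "orth_complement V = {y. \<forall>x\<in>V. cinner y x = 0}"

definition orth_proj :: "'a::chilbert_space set \<Rightarrow> 'a \<Rightarrow> 'a" where
  "orth_proj V x = (THE y. y \<in> V \<and> x - y \<in> orth_complement V)"


section \<open>Unbounded operators\<close>

text \<open>
  The values of \<open>app\<close> outside the domain carry no information. Equality of operators is
  therefore \<open>op_eq\<close> below, not HOL equality.
\<close>

datatype 'a operator = Operator (Dom: "'a set") (app: "'a \<Rightarrow> 'a")

notation app (infixl "\<cdot>" 80)

definition op_eq :: "'a operator \<Rightarrow> 'a operator \<Rightarrow> bool" where
  "op_eq S T \<longleftrightarrow> Dom S = Dom T \<and> (\<forall>u\<in>Dom S. S \<cdot> u = T \<cdot> u)"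

definition op_neg :: "'a::chilbert_space operator \<Rightarrow> 'a operator" where
  "op_neg T = Operator (Dom T) (\<lambda>u. - (T \<cdot> u))"

definition op_comp :: "'a operator \<Rightarrow> 'a operator \<Rightarrow> 'a operator" where
  "op_comp S T = Operator {u \<in> Dom T. T \<cdot> u \<in> Dom S} (\<lambda>u. S \<cdot> (T \<cdot> u))"

definition Ker :: "'a::chilbert_space operator \<Rightarrow> 'a set" where
  "Ker T = {u \<in> Dom T. T \<cdot> u = 0}"

definition Ran :: "'a operator \<Rightarrow> 'a set" where
  "Ran T = {T \<cdot> u | u. u \<in> Dom T}"

definition linear_op :: "'a::chilbert_space operator \<Rightarrow> bool" where
  "linear_op T \<longleftrightarrow> csubspace (Dom T) \<and>
     (\<forall>u\<in>Dom T. \<forall>v\<in>Dom T. T \<cdot> (u + v) = T \<cdot> u + T \<cdot> v) \<and>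
     (\<forall>c. \<forall>u\<in>Dom T. T \<cdot> (c *\<^sub>C u) = c *\<^sub>C (T \<cdot> u))"

definition densely_defined :: "'a::chilbert_space operator \<Rightarrow> bool" where
  "densely_defined T \<longleftrightarrow> closure (Dom T) = UNIV"

definition closed_op :: "'a::chilbert_space operator \<Rightarrow> bool" where
  "closed_op T \<longleftrightarrow> closed {(u, T \<cdot> u) | u. u \<in> Dom T}"

text \<open>Meaningful for densely defined operators, where the vector \<open>w\<close> is unique.\<close>

definition adjoint_op :: "'a::chilbert_space operator \<Rightarrow> 'a operator" where
  "adjoint_op T = Operator
     {v. \<exists>w. \<forall>u\<in>Dom T. cinner (T \<cdot> u) v = cinner u w}
     (\<lambda>v. THE w. \<forall>u\<in>Dom T. cinner (T \<cdot> u) v = cinner u w)"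

definition symmetric_op :: "'a::chilbert_space operator \<Rightarrow> bool" where
  "symmetric_op T \<longleftrightarrow> linear_op T \<and> densely_defined T \<and>
     (\<forall>u\<in>Dom T. \<forall>v\<in>Dom T. cinner (T \<cdot> u) v = cinner u (T \<cdot> v))"

definition self_adjoint_op :: "'a::chilbert_space operator \<Rightarrow> bool" where
  "self_adjoint_op T \<longleftrightarrow> linear_op T \<and> densely_defined T \<and> op_eq (adjoint_op T) T"

definition positive_op :: "'a::chilbert_space operator \<Rightarrow> bool" where
  "positive_op T \<longleftrightarrow> (\<forall>u\<in>Dom T. 0 \<le> Re (cinner (T \<cdot> u) u))"

text \<open>
  A positive self-adjoint operator has exactly one positive self-adjoint square root up to
  \<^const>\<open>op_eq\<close>; the choice operator only selects its irrelevant values outside the domain.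
\<close>

definition op_sqrt :: "'a::chilbert_space operator \<Rightarrow> 'a operator" where
  "op_sqrt T = (SOME S. self_adjoint_op S \<and> positive_op S \<and> op_eq (op_comp S S) T)"

definition graph_norm :: "'a::chilbert_space operator \<Rightarrow> 'a \<Rightarrow> real" where
  "graph_norm T u = norm u + norm (T \<cdot> u)"

definition relatively_compact ::
    "'a::chilbert_space operator \<Rightarrow> 'a operator \<Rightarrow> bool" where
  "relatively_compact S T \<longleftrightarrow> Dom T \<subseteq> Dom S \<and>
     compact (closure ((\<lambda>u. S \<cdot> u) ` {u \<in> Dom T. graph_norm T u \<le> 1}))"

definition eigenvalue :: "'a::chilbert_space operator \<Rightarrow> complex \<Rightarrow> bool" where
  "eigenvalue T z \<longleftrightarrow> (\<exists>u\<in>Dom T. u \<noteq> 0 \<and> T \<cdot> u = z *\<^sub>C u)"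


section \<open>Resolvent and spectrum\<close>

text \<open>
  The set \<open>Y\<close> is a closed subspace, and \<open>T\<close> is viewed as an operator in the Hilbert
  space \<open>Y\<close>, that is, with domain and values in \<open>Y\<close>.
\<close>

definition resolvent_set ::
    "'a::chilbert_space set \<Rightarrow> 'a operator \<Rightarrow> complex set" where
  "resolvent_set Y T = {z.
     bij_betw (\<lambda>u. z *\<^sub>C u - T \<cdot> u) (Dom T) Y \<and>
     (\<exists>M. \<forall>u\<in>Dom T. norm u \<le> M * norm (z *\<^sub>C u - T \<cdot> u))}"

definition spectrum ::
    "'a::chilbert_space set \<Rightarrow> 'a operator \<Rightarrow> complex set" where
  "spectrum Y T = - resolvent_set Y T"

definition resolvent ::
    "'a::chilbert_space operator \<Rightarrow> complex \<Rightarrow> 'a \<Rightarrow> 'a" where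
  "resolvent T z = inv_into (Dom T) (\<lambda>u. z *\<^sub>C u - T \<cdot> u)"

definition compact_resolvent :: "'a::chilbert_space operator \<Rightarrow> bool" where
  "compact_resolvent T \<longleftrightarrow>
     (\<exists>z\<in>resolvent_set UNIV T. compact (closure (resolvent T z ` cball 0 1)))"

definition opnorm_on :: "'a::chilbert_space set \<Rightarrow> ('a \<Rightarrow> 'a) \<Rightarrow> ereal" where
  "opnorm_on Y R = (SUP v\<in>{v \<in> Y. norm v \<le> 1}. ereal (norm (R v)))"


section \<open>The perturbed operators\<close>

definition L_op :: "'a::chilbert_space operator \<Rightarrow> 'a operator \<Rightarrow> real \<Rightarrow> 'a operator" where
  "L_op A \<Lambda> \<alpha> = Operator (Dom A) (\<lambda>u. A \<cdot> u - (\<i> * complex_of_real \<alpha>) *\<^sub>C (\<Lambda> \<cdot> u))"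

definition QL_op ::
    "'a::chilbert_space set \<Rightarrow> 'a operator \<Rightarrow> 'a operator \<Rightarrow> real \<Rightarrow> 'a operator" where
  "QL_op Y A \<Lambda> \<alpha> = Operator (Dom A \<inter> Y)
     (\<lambda>u. orth_proj Y (A \<cdot> u) - (\<i> * complex_of_real \<alpha>) *\<^sub>C orth_proj Y (\<Lambda> \<cdot> u))"

end

theory Submission
  imports Defs
begin

text \<open>
  Since \<open>\<langle>\<Lambda> u, B\<^sub>2 u\<rangle> = \<langle>B\<^sub>1 B\<^sub>2 u, B\<^sub>2 u\<rangle>\<close> is real, pairing \<open>f = (\<zeta> - Q L\<^sub>\<alpha>) u\<close> with \<open>B\<^sub>2 u\<close>
  bounds the energy \<open>\<langle>- A u, u\<rangle>\<close> by a multiple of \<open>\<parallel>f\<parallel>\<^sup>2\<close>, uniformly in \<open>\<alpha>\<close> and \<open>Re \<zeta> \<ge> 0\<close>;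
  continuation in \<open>\<alpha>\<close> then puts the closed right half plane in the resolvent set.
  If the resolvent on the imaginary axis did not become small, there would be normalized
  quasimodes with bounded energy. By compactness they converge strongly; pairing with \<open>\<Lambda> u\<close>
  bounds \<open>Q \<Lambda> u\<close>, the inclusion \<open>Ker \<Lambda> \<subseteq> D(\<Lambda>\<^sup>*)\<close> bounds \<open>(1 - Q) \<Lambda> u\<close>,
  and dividing the equation by \<open>\<alpha>\<close> gives in the weak limit
  \<open>\<Lambda> u = p - \<rho> u\<close> with \<open>\<rho>\<close> real, \<open>p \<in> Ker \<Lambda>\<close> and \<open>0 \<noteq> u \<in> (Ker \<Lambda>)\<^sup>\<bottom>\<close>. For \<open>\<rho> = 0\<close> this contradicts
  \<open>Ker \<Lambda> \<inter> Ran \<Lambda> = {0}\<close>; for \<open>\<rho> \<noteq> 0\<close> the vector \<open>p - \<rho> u\<close> is an eigenvector for \<open>- \<rho>\<close>.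
  The spectral bound is a perturbation of the resolvent bound, and in the whole space
  \<open>\<zeta> - L\<^sub>\<alpha>\<close> is block triangular with diagonal blocks \<open>\<zeta> - Q L\<^sub>\<alpha>\<close> and \<open>\<zeta> - A\<close>.
\<close>

section \<open>Complex inner product spaces\<close>

lemma scaleC_zero_left [simp]: "0 *\<^sub>C x = (0::'a::chilbert_space)"
  using scaleC_of_real[of 0 x] by simp

lemma scaleC_zero_right [simp]: "c *\<^sub>C (0::'a::chilbert_space) = 0"
  using scaleC_add_right[of c "0::'a" 0] by simp

lemma scaleC_minus_right: "c *\<^sub>C (- x) = - (c *\<^sub>C (x::'a::chilbert_space))"
  using scaleC_add_right[of c x "-x"] by (simp add: eq_neg_iff_add_eq_0 add.commute)

lemma scaleC_diff_right: "c *\<^sub>C (x - y) = c *\<^sub>C x - c *\<^sub>C (y::'a::chilbert_space)"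
  using scaleC_add_right[of c x "-y"] by (simp add: scaleC_minus_right)

lemma scaleC_scaleR: "c *\<^sub>C (r *\<^sub>R x) = r *\<^sub>R (c *\<^sub>C (x::'a::chilbert_space))"
  by (metis scaleC_of_real scaleC_scaleC mult.commute)

lemma cinner_scaleC_right: "cinner x (c *\<^sub>C y) = cnj c * cinner x (y::'a::chilbert_space)"
  by (metis cinner_commute cinner_scaleC_left complex_cnj_mult)

lemma cinner_add_right: "cinner x (y + z) = cinner x y + cinner x (z::'a::chilbert_space)"
  by (metis cinner_commute cinner_add_left complex_cnj_add)

lemma cinner_zero_left [simp]: "cinner 0 (x::'a::chilbert_space) = 0"
  using cinner_add_left[of 0 0 x] by simp

lemma cinner_zero_right [simp]: "cinner (x::'a::chilbert_space) 0 = 0"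
  using cinner_add_right[of x 0 0] by simp

lemma cinner_minus_left: "cinner (- x) (y::'a::chilbert_space) = - cinner x y"
  using cinner_add_left[of x "-x" y] by (simp add: eq_neg_iff_add_eq_0 add.commute)

lemma cinner_minus_right: "cinner x (- y::'a::chilbert_space) = - cinner x y"
  using cinner_add_right[of x y "-y"] by (simp add: eq_neg_iff_add_eq_0 add.commute)

lemma cinner_diff_left: "cinner (x - z) (y::'a::chilbert_space) = cinner x y - cinner z y"
  using cinner_add_left[of x "-z" y] by (simp add: cinner_minus_left)

lemma cinner_diff_right: "cinner x (y - z::'a::chilbert_space) = cinner x y - cinner x z"
  using cinner_add_right[of x y "-z"] by (simp add: cinner_minus_right)

text \<open>The second slot is conjugate linear, so multiplying it by \<open>\<i>\<close> multiplies
  the product by \<open>- \<i>\<close> and moves its imaginary part into the real part. Complex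
  identities thus reduce to pairs of real ones.\<close>

lemma Im_cinner: "Im (cinner x y) = inner x (\<i> *\<^sub>C (y::'a::chilbert_space))"
  by (simp flip: Re_cinner add: cinner_scaleC_right)

lemma cinner_eqI:
  fixes x y x' y' :: "'a::chilbert_space"
  assumes "inner x y = inner x' y'" "inner x (\<i> *\<^sub>C y) = inner x' (\<i> *\<^sub>C y')"
  shows "cinner x y = cinner x' y'"
  using assms by (intro complex_eqI) (simp_all add: Re_cinner Im_cinner)

lemma inner_scaleC_left: "inner (c *\<^sub>C x) y = inner (x::'a::chilbert_space) (cnj c *\<^sub>C y)"
  by (simp flip: Re_cinner add: cinner_scaleC_left cinner_scaleC_right)

lemma norm_scaleC: "norm (c *\<^sub>C x) = cmod c * norm (x::'a::chilbert_space)"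
proof -
  have "(norm (c *\<^sub>C x))\<^sup>2 = inner x ((cnj c * c) *\<^sub>C x)"
    by (simp add: power2_norm_eq_inner inner_scaleC_left scaleC_scaleC)
  also have "cnj c * c = complex_of_real ((cmod c)\<^sup>2)"
    by (simp add: complex_norm_square mult.commute del: of_real_power)
  also have "inner x (complex_of_real ((cmod c)\<^sup>2) *\<^sub>C x) = (cmod c * norm x)\<^sup>2"
    by (simp add: scaleC_of_real power_mult_distrib power2_norm_eq_inner del: of_real_power)
  finally show ?thesis
    by (simp add: power2_eq_iff_nonneg)
qed

lemma inner_scaleC_i_self: "inner x (\<i> *\<^sub>C x) = (0::real)" for x :: "'a::chilbert_space"
proof -
  have "inner x (\<i> *\<^sub>C x) = Im (cinner x x)" by (simp add: Im_cinner)
  moreover have "Im (cinner x x) = 0"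
    by (metis cinner_commute cnj.simps(2) add.inverse_neutral equal_neg_zero)
  ultimately show ?thesis by simp
qed

lemma cinner_le_norm: "cmod (cinner x y) \<le> norm x * norm (y::'a::chilbert_space)"
proof (cases "cinner x y = 0")
  case False
  \<comment> \<open>The phase \<open>c\<close> makes the product real and nonnegative, so the real
    Cauchy-Schwarz inequality suffices.\<close>
  define c where "c = cinner x y / cmod (cinner x y)"
  have "cmod c = 1" using False by (simp add: c_def norm_divide)
  have "cnj (cinner x y) * cinner x y = complex_of_real ((cmod (cinner x y))\<^sup>2)"
    by (simp add: complex_norm_square mult.commute del: of_real_power)
  hence "cnj c * cinner x y = complex_of_real (cmod (cinner x y))"
    using False by (simp add: c_def power2_eq_square)
  hence "cinner x (c *\<^sub>C y) = complex_of_real (cmod (cinner x y))"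
    by (simp add: cinner_scaleC_right)
  hence "cmod (cinner x y) = inner x (c *\<^sub>C y)"
    by (simp flip: Re_cinner)
  also have "\<dots> \<le> norm x * norm (c *\<^sub>C y)" by (rule norm_cauchy_schwarz)
  finally show ?thesis using \<open>cmod c = 1\<close> by (simp add: norm_scaleC)
qed simp

section \<open>Complex subspaces and orthogonal complements\<close>

lemma csubspace_scaleR: "csubspace V \<Longrightarrow> x \<in> V \<Longrightarrow> r *\<^sub>R x \<in> V"
  unfolding csubspace_def by (metis scaleC_of_real)

lemma csubspace_imp_subspace: "csubspace V \<Longrightarrow> subspace V"
  using csubspace_scaleR unfolding subspace_def csubspace_def by blast

lemma csubspace_diff: "csubspace V \<Longrightarrow> x \<in> V \<Longrightarrow> y \<in> V \<Longrightarrow> x - y \<in> V"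
  using csubspace_imp_subspace subspace_diff by blast

text \<open>A complex subspace is stable under \<open>\<i>\<close>, so testing the real part on all
  of \<open>V\<close> also tests the imaginary part.\<close>

lemma orth_complement_iff:
  assumes "csubspace V"
  shows "y \<in> orth_complement V \<longleftrightarrow> (\<forall>x\<in>V. inner y x = 0)"
proof
  assume "\<forall>x\<in>V. inner y x = 0"
  then show "y \<in> orth_complement V"
    using assms unfolding orth_complement_def csubspace_def
    by (auto intro!: complex_eqI simp: Re_cinner Im_cinner)
qed (auto simp: orth_complement_def simp flip: Re_cinner)

lemma csubspace_orth_complement: "csubspace (orth_complement V)"
  by (auto simp: csubspace_def orth_complement_def cinner_add_left cinner_scaleC_left)

lemma closed_orth_complement:
  assumes "csubspace V" shows "closed (orth_complement V)"
proof -
  have "orth_complement V = (\<Inter>x\<in>V. {y. inner y x = 0})"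
    using orth_complement_iff[OF assms] by auto
  moreover have "closed {y. inner y x = 0}" for x :: 'a
    by (intro closed_Collect_eq continuous_intros)
  ultimately show ?thesis by auto
qed

section \<open>Hilbert space geometry\<close>

text \<open>A minimizing sequence for the distance is Cauchy by the parallelogram law, and the first
  variation at the minimizer gives orthogonality. The real setting also covers the product space in
  which operator graphs live.\<close>

lemma orthogonal_projection_exists:
  fixes V :: "'b::{real_inner,complete_space} set"
  assumes "closed V" "subspace V"
  obtains y where "y \<in> V" "\<And>v. v \<in> V \<Longrightarrow> inner (x - y) v = 0"
proof -
  define d where "d = infdist x V"
  have "V \<noteq> {}" using assms(2) subspace_0 by blast
  have d_le: "d \<le> norm (x - v)" if "v \<in> V" for v
    unfolding d_def using infdist_le[OF that, of x] by (simp add: dist_norm)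
  have "d \<ge> 0" by (simp add: d_def infdist_nonneg)
  have "\<exists>v\<in>V. norm (x - v) < d + 1 / real (Suc n)" for n
  proof -
    have "(INF v\<in>V. dist x v) < d + 1 / real (Suc n)"
      using \<open>V \<noteq> {}\<close> by (simp add: d_def infdist_def)
    then show ?thesis
      using \<open>V \<noteq> {}\<close> by (subst (asm) cINF_less_iff) (auto simp: dist_norm intro!: bdd_belowI2[of _ 0])
  qed
  then obtain y where y: "y n \<in> V" "norm (x - y n) < d + 1 / real (Suc n)" for n
    by metis
  have yd: "(\<lambda>n. norm (x - y n)) \<longlonglongrightarrow> d"
  proof (rule tendsto_sandwich[OF _ _ tendsto_const])
    have "(\<lambda>n. d + 1 / real (Suc n)) \<longlonglongrightarrow> d + 0"
      by (intro tendsto_intros LIMSEQ_Suc[OF lim_1_over_n])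
    then show "(\<lambda>n. d + 1 / real (Suc n)) \<longlonglongrightarrow> d" by simp
  qed (use y d_le in \<open>auto intro!: always_eventually less_imp_le\<close>)
  \<comment> \<open>The midpoint of two points of \<open>V\<close> is again in \<open>V\<close>,
    hence at distance at least \<open>d\<close> from \<open>x\<close>; the parallelogram law turns
    this into a bound for the gap.\<close>
  have para: "(norm (y m - y n))\<^sup>2 \<le> 2 * (norm (x - y m))\<^sup>2 + 2 * (norm (x - y n))\<^sup>2 - 4 * d\<^sup>2" for m n
  proof -
    have mid: "(1/2) *\<^sub>R (y m + y n) \<in> V"
      using y assms(2) by (simp add: subspace_add subspace_scale)
    have "(x - y m) + (x - y n) = 2 *\<^sub>R (x - (1/2) *\<^sub>R (y m + y n))"
      by (simp add: algebra_simps scaleR_2)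
    hence "2 * d \<le> norm ((x - y m) + (x - y n))"
      using d_le[OF mid] by simp
    hence "(2 * d)\<^sup>2 \<le> (norm ((x - y m) + (x - y n)))\<^sup>2"
      using \<open>d \<ge> 0\<close> by (intro power_mono) auto
    moreover have "(norm (y m - y n))\<^sup>2 + (norm ((x - y m) + (x - y n)))\<^sup>2
        = 2 * (norm (x - y m))\<^sup>2 + 2 * (norm (x - y n))\<^sup>2"
      by (simp add: power2_norm_eq_inner inner_simps inner_commute algebra_simps)
    ultimately show ?thesis by (simp add: power_mult_distrib)
  qed
  have "Cauchy y"
  proof (rule metric_CauchyI)
    fix e :: real assume "e > 0"
    have "(\<lambda>n. (norm (x - y n))\<^sup>2) \<longlonglongrightarrow> d\<^sup>2" by (intro tendsto_intros yd)
    then have "\<forall>\<^sub>F n in sequentially. (norm (x - y n))\<^sup>2 < d\<^sup>2 + e\<^sup>2 / 4"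
      by (rule order_tendstoD) (use \<open>e > 0\<close> in auto)
    then obtain N where N: "\<And>n. n \<ge> N \<Longrightarrow> (norm (x - y n))\<^sup>2 < d\<^sup>2 + e\<^sup>2 / 4"
      by (auto simp: eventually_sequentially)
    have "dist (y m) (y n) < e" if "m \<ge> N" "n \<ge> N" for m n
    proof -
      have "(norm (y m - y n))\<^sup>2 < e\<^sup>2"
        using para[of m n] N[OF that(1)] N[OF that(2)] by linarith
      then show ?thesis
        using \<open>e > 0\<close> by (simp add: dist_norm power_less_imp_less_base)
    qed
    then show "\<exists>N. \<forall>m\<ge>N. \<forall>n\<ge>N. dist (y m) (y n) < e" by blast
  qed
  then obtain z where z: "y \<longlonglongrightarrow> z" using Cauchy_convergent convergent_def by blast
  have "z \<in> V" using assms(1) y(1) z closed_sequentially by blast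
  have "(\<lambda>n. norm (x - y n)) \<longlonglongrightarrow> norm (x - z)" by (intro tendsto_intros z)
  with yd have nz: "norm (x - z) = d" using LIMSEQ_unique by blast
  have "inner (x - z) v = 0" if "v \<in> V" for v
  proof (cases "v = 0")
    case False
    \<comment> \<open>The minimizer of the squared distance from \<open>x\<close> to
      \<open>z + t *\<^sub>R v\<close> as a function of \<open>t\<close>.\<close>
    define t where "t = inner (x - z) v / inner v v"
    have "inner v v > 0" using False by simp
    have "z + t *\<^sub>R v \<in> V"
      using \<open>z \<in> V\<close> that assms(2) by (simp add: subspace_add subspace_scale)
    then have "(norm (x - z))\<^sup>2 \<le> (norm (x - (z + t *\<^sub>R v)))\<^sup>2"
      using d_le nz by (intro power_mono) auto
    also have "\<dots> = (norm (x - z))\<^sup>2 - 2 * t * inner (x - z) v + t * t * inner v v"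
      by (simp add: power2_norm_eq_inner inner_simps inner_commute algebra_simps)
    finally have "2 * t * inner (x - z) v \<le> t * t * inner v v" by simp
    then have "(inner (x - z) v)\<^sup>2 \<le> 0"
      using \<open>inner v v > 0\<close> by (simp add: t_def power2_eq_square field_simps)
    then show ?thesis by simp
  qed simp
  then show ?thesis using that \<open>z \<in> V\<close> by blast
qed

text \<open>The residual of \<open>x0\<close> after projection to \<open>V\<close> is orthogonal to
  every \<open>x n\<close>, hence in the limit to \<open>x0\<close>, hence to itself.\<close>

lemma closed_subspace_weakly_closed:
  fixes V :: "'b::{real_inner,complete_space} set"
  assumes "closed V" "subspace V" "\<And>n::nat. x n \<in> V"
    and "\<And>z. (\<lambda>n. inner (x n) z) \<longlonglongrightarrow> inner x0 z"
  shows "x0 \<in> V"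
proof -
  obtain y where y: "y \<in> V" "\<And>v. v \<in> V \<Longrightarrow> inner (x0 - y) v = 0"
    using orthogonal_projection_exists[OF assms(1,2)] by blast
  have "inner (x n) (x0 - y) = 0" for n
    using y(2)[OF assms(3)] by (simp add: inner_commute)
  then have "inner x0 (x0 - y) = 0"
    using LIMSEQ_unique[OF assms(4)[of "x0 - y"], of 0] by simp
  then have "inner (x0 - y) (x0 - y) = 0"
    using y(2)[OF y(1)] by (simp add: inner_diff_left[of x0 y "x0 - y"] inner_commute[of y])
  then show ?thesis using y(1) by simp
qed

text \<open>Banach-Steinhaus for functionals represented by vectors: the closed sets
  \<open>E n\<close> cover the space, so by Baire one of them contains a ball, and testing inside
  that ball bounds each norm.\<close>

lemma uniform_boundedness:
  fixes B :: "'b::{real_inner,complete_space} set"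
  assumes "\<And>v. \<exists>K. \<forall>b\<in>B. \<bar>inner b v\<bar> \<le> K"
  shows "\<exists>K. \<forall>b\<in>B. norm b \<le> K"
proof -
  define E where "E n = {v. \<forall>b\<in>B. \<bar>inner b v\<bar> \<le> real n}" for n
  have "closed (E n)" for n
  proof -
    have "E n = (\<Inter>b\<in>B. {v. \<bar>inner b v\<bar> \<le> real n})" by (auto simp: E_def)
    moreover have "closed {v. \<bar>inner b v\<bar> \<le> real n}" for b :: 'b
      by (intro closed_Collect_le continuous_intros)
    ultimately show ?thesis by auto
  qed
  moreover have "(\<Union>n. E n) = UNIV"
  proof -
    have "v \<in> (\<Union>n. E n)" for v
    proof -
      obtain K where K: "\<forall>b\<in>B. \<bar>inner b v\<bar> \<le> K" using assms by blast
      obtain n where "K \<le> real n" using real_arch_simple by blast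
      then show ?thesis using K by (auto simp: E_def intro!: exI[of _ n] intro: order_trans)
    qed
    then show ?thesis by blast
  qed
  ultimately have "\<exists>n. interior (E n) \<noteq> {}"
    using Baire_category_alt[of euclidean "range E"] completely_metrizable_space_euclidean
    by (auto)
  then obtain n where "interior (E n) \<noteq> {}" by blast
  then obtain x e where "e > 0" and ball: "cball x e \<subseteq> E n"
    by (meson all_not_in_conv mem_interior_cball)
  have "norm b \<le> 2 * real n / e" if "b \<in> B" for b
  proof (cases "b = 0")
    case False
    \<comment> \<open>A vector of length \<open>e\<close> in the direction of \<open>b\<close>, on
      which the functional takes the value \<open>e * norm b\<close>.\<close>
    define v where "v = (e / norm b) *\<^sub>R b"
    have "norm v = e" using False \<open>e > 0\<close> by (simp add: v_def)
    then have "x + v \<in> E n" "x \<in> E n"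
      using ball \<open>e > 0\<close> by (auto simp: dist_norm)
    then have "\<bar>inner b (x + v)\<bar> \<le> real n" "\<bar>inner b x\<bar> \<le> real n"
      using that by (auto simp: E_def)
    then have "inner b v \<le> 2 * real n" by (simp add: inner_add_right)
    moreover have "inner b v = e * norm b"
      using False by (simp add: v_def power2_eq_square flip: power2_norm_eq_inner)
    ultimately show ?thesis using \<open>e > 0\<close> by (simp add: field_simps)
  qed (use \<open>e > 0\<close> in simp)
  then show ?thesis by blast
qed

section \<open>Square roots of positive operators\<close>

definition clinear_map :: "('a::chilbert_space \<Rightarrow> 'a) \<Rightarrow> bool" where
  "clinear_map X \<longleftrightarrow> (\<forall>x y. X (x + y) = X x + X y) \<and> (\<forall>c x. X (c *\<^sub>C x) = c *\<^sub>C X x)"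

lemma clinear_map_add: "clinear_map X \<Longrightarrow> X (x + y) = X x + X y"
  and clinear_map_scaleC: "clinear_map X \<Longrightarrow> X (c *\<^sub>C x) = c *\<^sub>C X x"
  by (simp_all add: clinear_map_def)

lemma clinear_map_scaleR: "clinear_map X \<Longrightarrow> X (r *\<^sub>R x) = r *\<^sub>R X x"
  by (metis clinear_map_scaleC scaleC_of_real)

lemma clinear_map_linear: "clinear_map X \<Longrightarrow> linear X"
  by (simp add: linear_iff clinear_map_add clinear_map_scaleR)

lemmas clinear_map_diff = linear_diff[OF clinear_map_linear]

text \<open>Real polynomials in \<open>R\<close> with nonnegative coefficients, together with an upper bound for
  the sum of the coefficients. If \<open>R\<close> is a contraction, this number bounds the operator norm.\<close>

inductive poly_cone :: "('a::chilbert_space \<Rightarrow> 'a) \<Rightarrow> ('a \<Rightarrow> 'a) \<Rightarrow> real \<Rightarrow> bool" for R where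
  scale: "c \<ge> 0 \<Longrightarrow> poly_cone R (\<lambda>x. c *\<^sub>R x) c"
| gen: "poly_cone R R 1"
| add: "poly_cone R X c \<Longrightarrow> poly_cone R Y d \<Longrightarrow> poly_cone R (\<lambda>x. X x + Y x) (c + d)"
| comp: "poly_cone R X c \<Longrightarrow> poly_cone R Y d \<Longrightarrow> poly_cone R (\<lambda>x. X (Y x)) (c * d)"

lemma poly_cone_half:
  "poly_cone R X c \<Longrightarrow> poly_cone R (\<lambda>x. (1/2) *\<^sub>R X x) (c / 2)"
  using poly_cone.comp[OF poly_cone.scale[of "1/2" R]] by simp

lemma tendsto_scaleC: "f \<longlonglongrightarrow> l \<Longrightarrow> (\<lambda>n. c *\<^sub>C f n) \<longlonglongrightarrow> c *\<^sub>C (l::'a::chilbert_space)"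
proof -
  assume "f \<longlonglongrightarrow> l"
  then have "(\<lambda>n. cmod c * norm (f n - l)) \<longlonglongrightarrow> cmod c * 0"
    by (intro tendsto_intros) (simp add: LIM_zero tendsto_norm_zero)
  then have "(\<lambda>n. norm (c *\<^sub>C f n - c *\<^sub>C l)) \<longlonglongrightarrow> 0"
    by (simp add: norm_scaleC flip: scaleC_diff_right)
  then show ?thesis by (simp add: LIM_zero_iff tendsto_norm_zero_iff)
qed

section \<open>Iterative construction of the square root of \<open>1 - R\<close>\<close>

locale sym_contraction =
  fixes R :: "'a::chilbert_space \<Rightarrow> 'a"
  assumes clinear: "clinear_map R"
    and sym: "inner (R x) y = inner x (R y)"
    and contraction: "norm (R x) \<le> norm x"
begin

lemma poly_cone_clinear: "poly_cone R X c \<Longrightarrow> clinear_map X"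
  by (induction rule: poly_cone.induct)
    (use clinear in \<open>auto simp: clinear_map_def scaleC_add_right scaleC_scaleR algebra_simps\<close>)

lemma poly_cone_norm: "poly_cone R X c \<Longrightarrow> c \<ge> 0 \<and> (\<forall>x. norm (X x) \<le> c * norm x)"
proof (induction rule: poly_cone.induct)
  case (add X c Y d)
  then show ?case
    by (auto simp: distrib_right intro: norm_triangle_le add_mono)
next
  case (comp X c Y d)
  have "norm (X (Y x)) \<le> c * d * norm x" for x
  proof -
    have "norm (X (Y x)) \<le> c * norm (Y x)" using comp by blast
    also have "\<dots> \<le> c * (d * norm x)" using comp by (intro mult_left_mono) auto
    finally show ?thesis by simp
  qed
  then show ?case using comp by simp
qed (use contraction in auto)

lemma poly_cone_commute_gen: "poly_cone R X c \<Longrightarrow> X (R x) = R (X x)"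
  by (induction arbitrary: x rule: poly_cone.induct)
    (auto simp: clinear_map_scaleR[OF clinear] clinear_map_add[OF clinear])

lemma poly_cone_commute: "poly_cone R Y d \<Longrightarrow> poly_cone R X c \<Longrightarrow> X (Y x) = Y (X x)"
proof (induction arbitrary: x rule: poly_cone.induct)
  case (scale c)
  then show ?case using clinear_map_scaleR[OF poly_cone_clinear] by blast
next
  case gen
  then show ?case by (rule poly_cone_commute_gen)
next
  case (add Y c Z d)
  then show ?case using clinear_map_add[OF poly_cone_clinear] by metis
qed metis

text \<open>Composition preserves symmetry here because all members are polynomials in the one
  operator \<open>R\<close> and hence commute.\<close>

lemma poly_cone_sym: "poly_cone R X c \<Longrightarrow> inner (X x) y = inner x (X y)"
proof (induction arbitrary: x y rule: poly_cone.induct)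
  case (comp X c Y d)
  then show ?case using poly_cone_commute by metis
qed (auto simp: sym inner_simps)

text \<open>Successive approximation, from zero, of a solution of
  \<open>Z = (R + Z\<^sup>2) / 2\<close>, that is of \<open>(1 - Z)\<^sup>2 = 1 - R\<close>.\<close>

fun iter :: "nat \<Rightarrow> 'a \<Rightarrow> 'a" where
  "iter 0 x = 0"
| "iter (Suc n) x = (1/2) *\<^sub>R (R x + iter n (iter n x))"

text \<open>The recursion of \<open>iter\<close> with \<open>R\<close> replaced by the scalar one;
  it records the coefficient sum of the polynomial \<open>iter n\<close>.\<close>

fun iter_bound :: "nat \<Rightarrow> real" where
  "iter_bound 0 = 0"
| "iter_bound (Suc n) = (1 + iter_bound n * iter_bound n) / 2"

lemma poly_cone_iter: "poly_cone R (iter n) (iter_bound n)"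
proof (induction n)
  case 0
  have "iter 0 = (\<lambda>x. 0 *\<^sub>R x)" by auto
  then show ?case using poly_cone.scale[of 0 R] by simp
next
  case (Suc n)
  have "poly_cone R (\<lambda>x. (1/2) *\<^sub>R (R x + iter n (iter n x))) ((1 + iter_bound n * iter_bound n) / 2)"
    by (intro poly_cone_half poly_cone.add poly_cone.gen poly_cone.comp Suc)
  moreover have "iter (Suc n) = (\<lambda>x. (1/2) *\<^sub>R (R x + iter n (iter n x)))" by auto
  ultimately show ?case by simp
qed

text \<open>For consecutive iterates \<open>Z\<close> and \<open>Z'\<close>, commutation writes the
  next difference as half the product of \<open>Z' - Z\<close> and \<open>Z' + Z\<close>.
  Nonnegative coefficients therefore persist by induction, and the bound of the difference is the
  difference of the bounds.\<close>

lemma poly_cone_iter_diff: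
  "poly_cone R (\<lambda>x. iter (Suc n) x - iter n x) (iter_bound (Suc n) - iter_bound n)"
proof (induction n)
  case 0
  show ?case using poly_cone_half[OF poly_cone.gen[of R]] by simp
next
  case (Suc n)
  let ?D = "\<lambda>x. iter (Suc n) x - iter n x"
  have cone: "poly_cone R (\<lambda>x. (1/2) *\<^sub>R ?D (iter (Suc n) x + iter n x))
      ((iter_bound (Suc n) - iter_bound n) * (iter_bound (Suc n) + iter_bound n) / 2)"
    by (intro poly_cone_half poly_cone.comp[OF Suc] poly_cone.add poly_cone_iter)
  have fun_eq: "(1/2) *\<^sub>R ?D (iter (Suc n) x + iter n x) = iter (Suc (Suc n)) x - iter (Suc n) x" for x
  proof -
    have "?D (iter (Suc n) x + iter n x) = ?D (iter (Suc n) x) + ?D (iter n x)"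
      by (rule clinear_map_add[OF poly_cone_clinear[OF Suc]])
    also have "\<dots> = iter (Suc n) (iter (Suc n) x) - iter n (iter n x)"
      using poly_cone_commute[OF poly_cone_iter poly_cone_iter, of n "Suc n" x] by simp
    also have "(1/2) *\<^sub>R \<dots> = iter (Suc (Suc n)) x - iter (Suc n) x"
      unfolding iter.simps(2)[of "Suc n"] by (simp add: algebra_simps)
    finally show ?thesis .
  qed
  have "(iter_bound (Suc n) - iter_bound n) * (iter_bound (Suc n) + iter_bound n) / 2
      = iter_bound (Suc (Suc n)) - iter_bound (Suc n)"
    by (simp add: field_simps)
  then show ?case using cone unfolding fun_eq by (simp only:)
qed

lemma iter_bound_incseq: "incseq iter_bound"
  using poly_cone_norm[OF poly_cone_iter_diff] by (simp add: incseq_Suc_iff)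

lemma iter_bound_le_one: "iter_bound n \<le> 1"
proof (induction n)
  case (Suc n)
  have "iter_bound n \<ge> 0" using poly_cone_norm[OF poly_cone_iter] by blast
  then have "iter_bound n * iter_bound n \<le> 1" using Suc by (intro mult_le_one)
  then show ?case by simp
qed simp

text \<open>Telescoping the one-step estimates compares the operators with a scalar sequence that
  increases and is bounded by one; convergence of the iteration follows from this.\<close>

lemma iter_diff_norm:
  assumes "m \<le> n"
  shows "norm (iter n x - iter m x) \<le> (iter_bound n - iter_bound m) * norm x"
  using assms
proof (induction n rule: dec_induct)
  case (step n)
  have "norm (iter (Suc n) x - iter m x) \<le> norm (iter (Suc n) x - iter n x) + norm (iter n x - iter m x)"
    by (metis norm_triangle_ineq diff_add_cancel add_diff_eq)
  also have "\<dots> \<le> (iter_bound (Suc n) - iter_bound n) * norm x + (iter_bound n - iter_bound m) * norm x"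
    by (intro add_mono step.IH) (use poly_cone_norm[OF poly_cone_iter_diff] in blast)
  finally show ?case by (simp add: algebra_simps)
qed simp

lemma iter_convergent: "convergent (\<lambda>n. iter n x)"
proof -
  have "convergent iter_bound"
    using incseq_convergent[OF iter_bound_incseq, of 1] iter_bound_le_one
    by (meson convergent_def)
  then have C: "Cauchy (\<lambda>n. iter_bound n * norm x)"
    by (intro convergent_Cauchy convergent_mult convergent_const)
  have "Cauchy (\<lambda>n. iter n x)"
  proof (rule metric_CauchyI)
    fix e :: real assume "e > 0"
    obtain N where N: "\<forall>m\<ge>N. \<forall>n\<ge>N. dist (iter_bound m * norm x) (iter_bound n * norm x) < e"
      using metric_CauchyD[OF C \<open>e > 0\<close>] by blast
    have *: "norm (iter n x - iter m x) < e" if "N \<le> m" "m \<le> n" for m n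
    proof -
      have "norm (iter n x - iter m x) \<le> iter_bound n * norm x - iter_bound m * norm x"
        using iter_diff_norm[OF that(2)] by (simp add: left_diff_distrib)
      also have "\<dots> \<le> dist (iter_bound n * norm x) (iter_bound m * norm x)"
        by (simp add: dist_real_def)
      also have "\<dots> < e" using N that by simp
      finally show ?thesis .
    qed
    have "dist (iter m x) (iter n x) < e" if "N \<le> m" "N \<le> n" for m n
      using *[of m n] *[of n m] that by (cases "m \<le> n") (auto simp: dist_norm norm_minus_commute)
    then show "\<exists>N. \<forall>m\<ge>N. \<forall>n\<ge>N. dist (iter m x) (iter n x) < e" by blast
  qed
  then show ?thesis by (simp add: Cauchy_convergent_iff)
qed

definition root_defect :: "'a \<Rightarrow> 'a" where
  "root_defect x = lim (\<lambda>n. iter n x)"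

lemma iter_tendsto: "(\<lambda>n. iter n x) \<longlonglongrightarrow> root_defect x"
  using iter_convergent convergent_LIMSEQ_iff root_defect_def by metis

lemma root_defect_clinear: "clinear_map root_defect"
  unfolding clinear_map_def
proof (intro conjI allI)
  fix x y c
  note lin = poly_cone_clinear[OF poly_cone_iter]
  show "root_defect (x + y) = root_defect x + root_defect y"
    using iter_tendsto[of "x + y"] tendsto_add[OF iter_tendsto[of x] iter_tendsto[of y]]
    by (simp add: clinear_map_add[OF lin] LIMSEQ_unique)
  show "root_defect (c *\<^sub>C x) = c *\<^sub>C root_defect x"
    using iter_tendsto[of "c *\<^sub>C x"] tendsto_scaleC[OF iter_tendsto[of x], of c]
    by (simp add: clinear_map_scaleC[OF lin] LIMSEQ_unique)
qed

lemma root_defect_sym: "inner (root_defect x) y = inner x (root_defect y)"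
  using tendsto_inner[OF iter_tendsto[of x] tendsto_const[of y]]
    tendsto_inner[OF tendsto_const[of x] iter_tendsto[of y]]
  by (simp add: poly_cone_sym[OF poly_cone_iter] LIMSEQ_unique)

lemma iter_norm: "norm (iter n x) \<le> norm x"
proof -
  have "norm (iter n x) \<le> iter_bound n * norm x"
    using poly_cone_norm[OF poly_cone_iter] by blast
  also have "\<dots> \<le> 1 * norm x" by (intro mult_right_mono iter_bound_le_one) auto
  finally show ?thesis by simp
qed

lemma root_defect_norm: "norm (root_defect x) \<le> norm x"
  by (rule LIMSEQ_le_const2[OF tendsto_norm[OF iter_tendsto]]) (use iter_norm in blast)

lemma root_defect_fixpoint: "root_defect x = (1/2) *\<^sub>R (R x + root_defect (root_defect x))"
proof -
  \<comment> \<open>Operator and argument both vary with \<open>n\<close>; uniform contractivity of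
    the iterates lets the argument be replaced by its limit.\<close>
  have "(\<lambda>n. iter n (iter n x - root_defect x)) \<longlonglongrightarrow> 0"
  proof (rule Lim_null_comparison)
    show "(\<lambda>n. norm (iter n x - root_defect x)) \<longlonglongrightarrow> 0"
      using iter_tendsto by (simp add: LIM_zero tendsto_norm_zero)
  qed (simp add: iter_norm)
  then have "(\<lambda>n. iter n (iter n x - root_defect x) + iter n (root_defect x)) \<longlonglongrightarrow> 0 + root_defect (root_defect x)"
    by (intro tendsto_add iter_tendsto)
  then have "(\<lambda>n. iter n (iter n x)) \<longlonglongrightarrow> root_defect (root_defect x)"
    by (simp add: clinear_map_diff[OF poly_cone_clinear[OF poly_cone_iter]])
  then have "(\<lambda>n. iter (Suc n) x) \<longlonglongrightarrow> (1/2) *\<^sub>R (R x + root_defect (root_defect x))"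
    by (auto intro!: tendsto_intros)
  moreover have "(\<lambda>n. iter (Suc n) x) \<longlonglongrightarrow> root_defect x"
    by (intro LIMSEQ_Suc iter_tendsto)
  ultimately show ?thesis by (rule LIMSEQ_unique[rotated])
qed

end

text \<open>The hypothesis \<^prop>\<open>(norm (T x))\<^sup>2 \<le> inner (T x) x\<close> says \<open>0 \<le> T \<le> 1\<close> for symmetric \<open>T\<close>.
  The root is \<open>1 - Z\<close> where \<open>Z\<close> solves \<open>2 Z = (1 - T) + Z\<^sup>2\<close>.\<close>

lemma positive_root_exists:
  fixes T :: "'a::chilbert_space \<Rightarrow> 'a"
  assumes lin: "clinear_map T"
    and sym: "\<And>x y. inner (T x) y = inner x (T y)"
    and bnd: "\<And>x. (norm (T x))\<^sup>2 \<le> inner (T x) x"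
  obtains H where "clinear_map H" "\<And>x y. inner (H x) y = inner x (H y)"
    "\<And>x. inner (H x) x \<ge> 0" "\<And>x. H (H x) = T x"
proof -
  interpret sym_contraction "\<lambda>x. x - T x"
  proof
    show "clinear_map (\<lambda>x. x - T x)"
      using lin by (auto simp: clinear_map_def scaleC_diff_right)
    show "inner (x - T x) y = inner x (y - T y)" for x y
      by (simp add: inner_simps sym)
    show "norm (x - T x) \<le> norm x" for x
    proof (rule power2_le_imp_le)
      have "(norm (x - T x))\<^sup>2 = (norm x)\<^sup>2 - 2 * inner (T x) x + (norm (T x))\<^sup>2"
        by (simp add: power2_norm_eq_inner inner_simps inner_commute)
      moreover have "0 \<le> inner (T x) x" using bnd[of x] by (rule order_trans[rotated]) simp
      ultimately show "(norm (x - T x))\<^sup>2 \<le> (norm x)\<^sup>2" using bnd[of x] by linarith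
    qed simp
  qed
  note Z = root_defect_clinear
  let ?H = "\<lambda>x. x - root_defect x"
  show ?thesis
  proof (rule that[of ?H])
    show "clinear_map ?H" using Z by (auto simp: clinear_map_def scaleC_diff_right)
    show "inner (?H x) y = inner x (?H y)" for x y
      by (simp add: inner_simps root_defect_sym)
    show "inner (?H x) x \<ge> 0" for x
    proof -
      have "inner (root_defect x) x \<le> norm (root_defect x) * norm x" by (rule norm_cauchy_schwarz)
      also have "\<dots> \<le> norm x * norm x" by (intro mult_right_mono root_defect_norm) simp
      finally show ?thesis
        by (simp add: inner_simps power2_norm_eq_inner[symmetric] power2_eq_square)
    qed
    show "?H (?H x) = T x" for x
    proof -
      have "2 *\<^sub>R root_defect x = (x - T x) + root_defect (root_defect x)"
        by (subst root_defect_fixpoint) simp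
      then have "root_defect (root_defect x) = 2 *\<^sub>R root_defect x - x + T x"
        by (simp add: algebra_simps)
      then show ?thesis by (simp add: clinear_map_diff[OF Z] scaleR_2)
    qed
  qed
qed

section \<open>Self-adjoint operators\<close>

lemma linear_op_csubspace: "linear_op T \<Longrightarrow> csubspace (Dom T)"
  by (simp add: linear_op_def)

lemma linear_op_add: "linear_op T \<Longrightarrow> u \<in> Dom T \<Longrightarrow> v \<in> Dom T \<Longrightarrow> T \<cdot> (u + v) = T \<cdot> u + T \<cdot> v"
  and linear_op_scaleC: "linear_op T \<Longrightarrow> u \<in> Dom T \<Longrightarrow> T \<cdot> (c *\<^sub>C u) = c *\<^sub>C (T \<cdot> u)"
  by (auto simp: linear_op_def)

lemma Dom_add: "linear_op T \<Longrightarrow> u \<in> Dom T \<Longrightarrow> v \<in> Dom T \<Longrightarrow> u + v \<in> Dom T"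
  and Dom_scaleC: "linear_op T \<Longrightarrow> u \<in> Dom T \<Longrightarrow> c *\<^sub>C u \<in> Dom T"
  and Dom_zero: "linear_op T \<Longrightarrow> 0 \<in> Dom T"
  by (auto simp: linear_op_def csubspace_def)

lemma Dom_scaleR: "linear_op T \<Longrightarrow> u \<in> Dom T \<Longrightarrow> r *\<^sub>R u \<in> Dom T"
  using Dom_scaleC scaleC_of_real by metis

lemma Dom_diff: "linear_op T \<Longrightarrow> u \<in> Dom T \<Longrightarrow> v \<in> Dom T \<Longrightarrow> u - v \<in> Dom T"
  using linear_op_csubspace csubspace_diff by blast

lemma linear_op_scaleR: "linear_op T \<Longrightarrow> u \<in> Dom T \<Longrightarrow> T \<cdot> (r *\<^sub>R u) = r *\<^sub>R (T \<cdot> u)"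
  using linear_op_scaleC scaleC_of_real by metis

lemma linear_op_zero: "linear_op T \<Longrightarrow> T \<cdot> 0 = 0"
  using linear_op_scaleR[of T 0 0] Dom_zero by fastforce

lemma linear_op_diff: "linear_op T \<Longrightarrow> u \<in> Dom T \<Longrightarrow> v \<in> Dom T \<Longrightarrow> T \<cdot> (u - v) = T \<cdot> u - T \<cdot> v"
  using linear_op_add[of T u "(-1) *\<^sub>R v"] linear_op_scaleR[of T v "-1"] Dom_scaleR[of T v "-1"]
  by simp

text \<open>The norm bound makes the error of replacing \<open>z\<close> by a nearby
  \<open>u\<close> in \<open>D\<close> uniform in \<open>n\<close>. With \<open>D\<close> the domain
  of \<open>A\<close>, the unbounded operator can be moved onto the test vector.\<close>

lemma dense_tendsto_inner_zero:
  fixes D :: "'b::real_inner set"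
  assumes "closure D = UNIV" "\<And>n. norm (g n) \<le> K"
    and "\<And>u. u \<in> D \<Longrightarrow> (\<lambda>n. inner (g n) u) \<longlonglongrightarrow> 0"
  shows "(\<lambda>n. inner (g n) z) \<longlonglongrightarrow> 0"
proof (rule LIMSEQ_I)
  fix e :: real assume "e > 0"
  have "K \<ge> 0" using assms(2)[of 0] norm_ge_zero order_trans by blast
  have "z \<in> closure D" using assms(1) by simp
  moreover have "e / (2 * (K + 1)) > 0" using \<open>e > 0\<close> \<open>K \<ge> 0\<close> by simp
  ultimately obtain u where u: "u \<in> D" "dist u z < e / (2 * (K + 1))"
    unfolding closure_approachable by blast
  obtain N where N: "\<And>n. n \<ge> N \<Longrightarrow> norm (inner (g n) u) < e / 2"
    using LIMSEQ_D[OF assms(3)[OF u(1)], of "e / 2"] \<open>e > 0\<close> by auto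
  have "norm (inner (g n) z - 0) < e" if "n \<ge> N" for n
  proof -
    have "\<bar>inner (g n) (z - u)\<bar> \<le> norm (g n) * norm (z - u)" by (rule Cauchy_Schwarz_ineq2)
    also have "\<dots> \<le> (K + 1) * (e / (2 * (K + 1)))"
      using assms(2)[of n] u(2) \<open>K \<ge> 0\<close>
      by (intro mult_mono) (auto simp: dist_norm norm_minus_commute)
    also have "\<dots> = e / 2" using \<open>K \<ge> 0\<close> by (simp add: field_simps)
    finally have "\<bar>inner (g n) z - inner (g n) u\<bar> \<le> e / 2" by (simp add: inner_diff_right)
    moreover have "\<bar>inner (g n) u\<bar> < e / 2" using N[OF that] by simp
    ultimately show ?thesis unfolding real_norm_def diff_0_right by linarith
  qed
  then show "\<exists>N. \<forall>n\<ge>N. norm (inner (g n) z - 0) < e" by blast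
qed

lemma dense_inner_zero:
  fixes D :: "'b::real_inner set"
  assumes "closure D = UNIV" "\<And>u. u \<in> D \<Longrightarrow> inner u w = 0"
  shows "w = 0"
  using dense_tendsto_inner_zero[of D "\<lambda>_. w" "norm w" w] assms
  by (simp add: inner_commute LIMSEQ_const_iff)

section \<open>Adjoints, maximality and closedness\<close>

lemma adjoint_op_apply:
  assumes "densely_defined T" "\<And>u. u \<in> Dom T \<Longrightarrow> cinner (T \<cdot> u) v = cinner u w"
  shows "v \<in> Dom (adjoint_op T)" "adjoint_op T \<cdot> v = w"
proof -
  show "v \<in> Dom (adjoint_op T)" using assms(2) by (auto simp: adjoint_op_def)
  have "w' = w" if "\<forall>u\<in>Dom T. cinner (T \<cdot> u) v = cinner u w'" for w'
  proof -
    have "inner u (w' - w) = 0" if "u \<in> Dom T" for u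
    proof -
      have "cinner u (w' - w) = 0"
        using assms(2)[OF that] \<open>\<forall>u\<in>Dom T. _ u\<close> that by (simp add: cinner_diff_right)
      then show ?thesis by (simp flip: Re_cinner)
    qed
    then show ?thesis
      using dense_inner_zero[of "Dom T" "w' - w"] assms(1) by (simp add: densely_defined_def)
  qed
  then show "adjoint_op T \<cdot> v = w"
    using assms(2) by (auto simp: adjoint_op_def intro!: the_equality)
qed

lemma self_adjoint_sym:
  assumes "self_adjoint_op T" "u \<in> Dom T" "v \<in> Dom T"
  shows "cinner (T \<cdot> u) v = cinner u (T \<cdot> v)"
proof -
  have eq: "v \<in> Dom (adjoint_op T)" "adjoint_op T \<cdot> v = T \<cdot> v" and "densely_defined T"
    using assms by (auto simp: self_adjoint_op_def op_eq_def)
  from eq(1) obtain w where w: "\<forall>u\<in>Dom T. cinner (T \<cdot> u) v = cinner u w"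
    by (auto simp: adjoint_op_def)
  with \<open>densely_defined T\<close> have "adjoint_op T \<cdot> v = w" by (intro adjoint_op_apply) auto
  with w eq(2) assms(2) show ?thesis by simp
qed

lemma self_adjoint_maximal:
  assumes "self_adjoint_op T" "\<And>u. u \<in> Dom T \<Longrightarrow> cinner (T \<cdot> u) v = cinner u w"
  shows "v \<in> Dom T" "T \<cdot> v = w"
  using assms adjoint_op_apply[of T v w] by (auto simp: self_adjoint_op_def op_eq_def)

lemma self_adjoint_opI:
  assumes "linear_op T" "densely_defined T"
    and "\<And>u v. u \<in> Dom T \<Longrightarrow> v \<in> Dom T \<Longrightarrow> cinner (T \<cdot> u) v = cinner u (T \<cdot> v)"
    and "\<And>v w. (\<And>u. u \<in> Dom T \<Longrightarrow> cinner (T \<cdot> u) v = cinner u w) \<Longrightarrow> v \<in> Dom T"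
  shows "self_adjoint_op T"
proof -
  have *: "v \<in> Dom (adjoint_op T)" "adjoint_op T \<cdot> v = T \<cdot> v" if "v \<in> Dom T" for v
    using adjoint_op_apply[OF assms(2), of v "T \<cdot> v"] assms(3) that by auto
  moreover have "v \<in> Dom T" if "v \<in> Dom (adjoint_op T)" for v
    using that assms(4) by (fastforce simp: adjoint_op_def)
  ultimately have "Dom (adjoint_op T) = Dom T" "\<forall>v\<in>Dom T. adjoint_op T \<cdot> v = T \<cdot> v" by blast+
  then show ?thesis using assms(1,2) by (simp add: self_adjoint_op_def op_eq_def)
qed

lemma self_adjoint_closed:
  assumes "self_adjoint_op T" "\<And>n. u n \<in> Dom T" "u \<longlonglongrightarrow> x" "(\<lambda>n. T \<cdot> u n) \<longlonglongrightarrow> y"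
  shows "x \<in> Dom T" "T \<cdot> x = y"
proof -
  have lin: "linear_op T" using assms(1) by (simp add: self_adjoint_op_def)
  have re: "inner (T \<cdot> v) x = inner v y" if "v \<in> Dom T" for v
  proof -
    have "inner (T \<cdot> v) (u n) = inner v (T \<cdot> u n)" for n
      using self_adjoint_sym[OF assms(1) that assms(2)] by (metis Re_cinner)
    then show ?thesis
      using tendsto_inner[OF tendsto_const assms(3), of "T \<cdot> v"]
        tendsto_inner[OF tendsto_const assms(4), of v] LIMSEQ_unique by simp
  qed
  \<comment> \<open>Replacing \<open>v\<close> by \<open>- \<i>\<close> times \<open>v\<close> in
    \<open>re\<close> yields the imaginary part.\<close>
  have "cinner (T \<cdot> v) x = cinner v y" if v: "v \<in> Dom T" for v
    using re[OF v] re[OF Dom_scaleC[OF lin v, of "- \<i>"]]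
    by (intro cinner_eqI) (simp_all add: linear_op_scaleC[OF lin v] inner_scaleC_left)
  then show "x \<in> Dom T" "T \<cdot> x = y"
    using self_adjoint_maximal[OF assms(1)] by blast+
qed

section \<open>Coercive operators and the solvability of shifted equations\<close>

locale coercive_operator =
  fixes A :: "'a::chilbert_space operator"
  assumes self_adjoint: "self_adjoint_op A"
    and coercive: "u \<in> Dom A \<Longrightarrow> (norm u)\<^sup>2 \<le> inner (- (A \<cdot> u)) u"
begin

lemma lin_A: "linear_op A" and dense_A: "closure (Dom A) = UNIV"
  using self_adjoint by (auto simp: self_adjoint_op_def densely_defined_def)

lemma sym_A: "u \<in> Dom A \<Longrightarrow> v \<in> Dom A \<Longrightarrow> inner (A \<cdot> u) v = inner u (A \<cdot> v)"
  using self_adjoint_sym[OF self_adjoint] by (metis Re_cinner)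

text \<open>Pairing with \<open>u\<close>: by coercivity the form of \<open>A\<close> is at most
  \<open>- (norm u)\<^sup>2\<close>, so the shift leaves the margin \<open>Re z + 1\<close>.\<close>

lemma shift_lower_bound:
  assumes "u \<in> Dom A"
  shows "(Re z + 1) * norm u \<le> norm (z *\<^sub>C u - A \<cdot> u)"
proof (cases "u = 0")
  case False
  have "inner (z *\<^sub>C u) u = Re z * (norm u)\<^sup>2"
  proof -
    have "cinner u u = complex_of_real ((norm u)\<^sup>2)"
      by (intro complex_eqI) (simp_all add: Re_cinner Im_cinner inner_scaleC_i_self power2_norm_eq_inner del: of_real_power)
    then show ?thesis by (simp add: cinner_scaleC_left del: of_real_power flip: Re_cinner)
  qed
  then have "(Re z + 1) * (norm u)\<^sup>2 \<le> inner (z *\<^sub>C u - A \<cdot> u) u"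
    using coercive[OF assms] by (simp add: inner_simps algebra_simps)
  also have "\<dots> \<le> norm (z *\<^sub>C u - A \<cdot> u) * norm u" by (rule norm_cauchy_schwarz)
  finally show ?thesis using False by (simp add: power2_eq_square)
qed simp

text \<open>The lower bound makes the range closed. A vector \<open>w\<close> orthogonal to the
  range satisfies \<open>A \<cdot> w = cnj z *\<^sub>C w\<close>, which the same lower bound at
  \<open>cnj z\<close> excludes unless \<open>w = 0\<close>.\<close>

lemma shift_surj:
  assumes "Re z > -1"
  shows "\<exists>u\<in>Dom A. z *\<^sub>C u - A \<cdot> u = f"
proof -
  define V where "V = (\<lambda>u. z *\<^sub>C u - A \<cdot> u) ` Dom A"
  note lin = linear_op_add[OF lin_A] linear_op_scaleC[OF lin_A] linear_op_zero[OF lin_A]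
  have "csubspace V"
    unfolding csubspace_def
  proof (intro conjI ballI allI)
    show "0 \<in> V" unfolding V_def using Dom_zero[OF lin_A] by (force simp: lin)
    show "x + y \<in> V" if "x \<in> V" "y \<in> V" for x y
    proof -
      obtain u v where "u \<in> Dom A" "v \<in> Dom A" "x = z *\<^sub>C u - A \<cdot> u" "y = z *\<^sub>C v - A \<cdot> v"
        using \<open>x \<in> V\<close> \<open>y \<in> V\<close> unfolding V_def by blast
      then show ?thesis unfolding V_def
        by (intro image_eqI[of _ _ "u + v"]) (auto simp: lin scaleC_add_right Dom_add[OF lin_A])
    qed
    show "c *\<^sub>C x \<in> V" if "x \<in> V" for c x
    proof -
      obtain u where "u \<in> Dom A" "x = z *\<^sub>C u - A \<cdot> u"
        using \<open>x \<in> V\<close> unfolding V_def by blast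
      then show ?thesis unfolding V_def
        by (intro image_eqI[of _ _ "c *\<^sub>C u"])
          (auto simp: lin scaleC_diff_right scaleC_scaleC mult.commute Dom_scaleC[OF lin_A])
    qed
  qed
  have "closed V"
    unfolding closed_sequential_limits
  proof (intro allI impI)
    fix y l assume yl: "(\<forall>n. y n \<in> V) \<and> y \<longlonglongrightarrow> l"
    then have "\<forall>n. \<exists>u. u \<in> Dom A \<and> y n = z *\<^sub>C u - A \<cdot> u" by (auto simp: V_def)
    then obtain u where u: "\<And>n. u n \<in> Dom A" "\<And>n. y n = z *\<^sub>C u n - A \<cdot> u n" by metis
    have est: "(Re z + 1) * norm (u m - u n) \<le> norm (y m - y n)" for m n
    proof -
      have "y m - y n = z *\<^sub>C (u m - u n) - A \<cdot> (u m - u n)"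
        using u by (simp add: scaleC_diff_right linear_op_diff[OF lin_A])
      then show ?thesis
        using shift_lower_bound[of "u m - u n" z] u Dom_diff[OF lin_A] by simp
    qed
    have "Cauchy u"
    proof (rule metric_CauchyI)
      fix e :: real assume "e > 0"
      then have "(Re z + 1) * e > 0" using assms by simp
      moreover have "Cauchy y" using yl LIMSEQ_imp_Cauchy by blast
      ultimately obtain N where N: "\<forall>m\<ge>N. \<forall>n\<ge>N. dist (y m) (y n) < (Re z + 1) * e"
        using metric_CauchyD by blast
      have "dist (u m) (u n) < e" if "m \<ge> N" "n \<ge> N" for m n
      proof -
        have "(Re z + 1) * norm (u m - u n) < (Re z + 1) * e"
          using est[of m n] N that by (auto simp: dist_norm intro: order_le_less_trans)
        then show ?thesis using assms by (simp add: dist_norm)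
      qed
      then show "\<exists>N. \<forall>m\<ge>N. \<forall>n\<ge>N. dist (u m) (u n) < e" by blast
    qed
    then obtain x where x: "u \<longlonglongrightarrow> x" using Cauchy_convergent convergent_def by blast
    have "(\<lambda>n. z *\<^sub>C u n - y n) \<longlonglongrightarrow> z *\<^sub>C x - l"
      using yl x by (intro tendsto_diff tendsto_scaleC) auto
    then have "(\<lambda>n. A \<cdot> u n) \<longlonglongrightarrow> z *\<^sub>C x - l" using u by simp
    then have "x \<in> Dom A" "A \<cdot> x = z *\<^sub>C x - l"
      using self_adjoint_closed[OF self_adjoint u(1) x] by auto
    then show "l \<in> V" unfolding V_def by (intro image_eqI[of _ _ x]) auto
  qed
  obtain p where p: "p \<in> V" "\<And>v. v \<in> V \<Longrightarrow> inner (f - p) v = 0"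
    using orthogonal_projection_exists[OF \<open>closed V\<close> csubspace_imp_subspace[OF \<open>csubspace V\<close>]] by blast
  define w where "w = f - p"
  have "w \<in> orth_complement V" using p(2) orth_complement_iff[OF \<open>csubspace V\<close>] by (simp add: w_def)
  then have "cinner w (z *\<^sub>C u - A \<cdot> u) = 0" if "u \<in> Dom A" for u
    using that by (auto simp: orth_complement_def V_def)
  then have "cinner (z *\<^sub>C u - A \<cdot> u) w = 0" if "u \<in> Dom A" for u
    using that cinner_commute[of "z *\<^sub>C u - A \<cdot> u" w] by simp
  then have "cinner (A \<cdot> u) w = cinner u (cnj z *\<^sub>C w)" if "u \<in> Dom A" for u
    using that by (simp add: cinner_diff_left cinner_scaleC_left cinner_scaleC_right)
  then have w: "w \<in> Dom A" "A \<cdot> w = cnj z *\<^sub>C w"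
    using self_adjoint_maximal[OF self_adjoint] by blast+
  have "(Re (cnj z) + 1) * norm w \<le> 0" using shift_lower_bound[OF w(1), of "cnj z"] w(2) by simp
  then have "w = 0" using assms by (simp add: mult_le_0_iff)
  then show ?thesis using p(1) by (auto simp: w_def V_def)
qed

lemma shift_ex1:
  assumes "Re z > -1"
  shows "\<exists>!u. u \<in> Dom A \<and> z *\<^sub>C u - A \<cdot> u = f"
proof -
  obtain u where u: "u \<in> Dom A" "z *\<^sub>C u - A \<cdot> u = f" using shift_surj[OF assms] by blast
  moreover have "v = u" if v: "v \<in> Dom A" "z *\<^sub>C v - A \<cdot> v = f" for v
  proof -
    have "z *\<^sub>C (v - u) - A \<cdot> (v - u) = 0"
      using u v by (simp add: scaleC_diff_right linear_op_diff[OF lin_A] algebra_simps)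
    then have "(Re z + 1) * norm (v - u) \<le> 0"
      using shift_lower_bound[of "v - u" z] Dom_diff[OF lin_A v(1) u(1)] by simp
    then show ?thesis using assms by (simp add: mult_le_0_iff)
  qed
  ultimately show ?thesis by blast
qed

section \<open>The bounded inverse of \<open>- A\<close> and the square root of
  \<open>- A\<close>\<close>

definition inverse_neg :: "'a \<Rightarrow> 'a" where
  "inverse_neg f = (THE u. u \<in> Dom A \<and> - (A \<cdot> u) = f)"

lemma inverse_neg: "inverse_neg f \<in> Dom A" "- (A \<cdot> inverse_neg f) = f"
  using theI'[OF shift_ex1[of 0 f]] by (simp_all add: inverse_neg_def)

lemma inverse_neg_eqI: "u \<in> Dom A \<Longrightarrow> - (A \<cdot> u) = f \<Longrightarrow> inverse_neg f = u"
  using shift_ex1[of 0 f] inverse_neg[of f] by auto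

lemma inverse_neg_clinear: "clinear_map inverse_neg"
  unfolding clinear_map_def
proof (intro conjI allI; rule inverse_neg_eqI)
  fix x y c
  show "inverse_neg x + inverse_neg y \<in> Dom A" "c *\<^sub>C inverse_neg x \<in> Dom A"
    using inverse_neg Dom_add[OF lin_A] Dom_scaleC[OF lin_A] by auto
  show "- (A \<cdot> (inverse_neg x + inverse_neg y)) = x + y"
    using inverse_neg[of x] inverse_neg[of y] linear_op_add[OF lin_A inverse_neg(1) inverse_neg(1), of x y]
    by (metis minus_add_distrib)
  show "- (A \<cdot> (c *\<^sub>C inverse_neg x)) = c *\<^sub>C x"
    using inverse_neg[of x] linear_op_scaleC[OF lin_A inverse_neg(1)] by (metis scaleC_minus_right)
qed

lemma inverse_neg_sym: "inner (inverse_neg x) y = inner x (inverse_neg y)"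
proof -
  have "inner (inverse_neg x) (- (A \<cdot> inverse_neg y)) = inner (- (A \<cdot> inverse_neg x)) (inverse_neg y)"
    using sym_A[OF inverse_neg(1) inverse_neg(1)] by simp
  then show ?thesis by (simp add: inverse_neg(2))
qed

text \<open>Coercivity evaluated at the solution. In this form it says that the inverse lies between
  0 and 1, as \<open>positive_root_exists\<close> requires.\<close>

lemma inverse_neg_bound: "(norm (inverse_neg x))\<^sup>2 \<le> inner (inverse_neg x) x"
  using coercive[OF inverse_neg(1), of x] by (simp add: inverse_neg(2) inner_commute)

lemma norm_inverse_neg_le: "norm (inverse_neg x) \<le> norm x"
  using shift_lower_bound[OF inverse_neg(1), of 0 x] inverse_neg(2)[of x] by simp

text \<open>\<open>op_sqrt\<close> is a choice, so existence must come first. The bounded inverse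
  has a bounded symmetric root \<open>H\<close>, and the inverse of \<open>H\<close> is the wanted
  root; it is self-adjoint since \<open>H\<close> is symmetric and defined everywhere.\<close>

lemma sqrt_exists: "\<exists>S. self_adjoint_op S \<and> positive_op S \<and> op_eq (op_comp S S) (op_neg A)"
proof -
  obtain H where H: "clinear_map H" "\<And>x y. inner (H x) y = inner x (H y)"
    "\<And>x. inner (H x) x \<ge> 0" "\<And>x. H (H x) = inverse_neg x"
    using positive_root_exists[OF inverse_neg_clinear inverse_neg_sym inverse_neg_bound] by blast
  have csym: "cinner (H x) y = cinner x (H y)" for x y
    by (rule cinner_eqI) (simp_all add: H(2) flip: clinear_map_scaleC[OF H(1)])
  have inj: "inj H"
  proof (rule injI)
    fix x y assume "H x = H y"
    then have "inverse_neg x = inverse_neg y" by (metis H(4))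
    then show "x = y" using inverse_neg(2) by metis
  qed
  define S where "S = Operator (range H) (inv H)"
  have SH: "S \<cdot> H x = x" for x using inj by (simp add: S_def)
  have DomS: "Dom S = range H" by (simp add: S_def)
  have H0: "H 0 = 0" using clinear_map_scaleC[OF H(1), of 0 0] by simp
  have "linear_op S"
    unfolding linear_op_def csubspace_def DomS
  proof (intro conjI ballI allI)
    show "0 \<in> range H" using H0 by (metis rangeI)
    fix u v c assume uv: "u \<in> range H"
    then obtain x where x: "u = H x" by blast
    then have cu: "c *\<^sub>C u = H (c *\<^sub>C x)" by (simp add: clinear_map_scaleC[OF H(1)])
    show "c *\<^sub>C u \<in> range H" unfolding cu by simp
    show "S \<cdot> (c *\<^sub>C u) = c *\<^sub>C (S \<cdot> u)" unfolding cu unfolding x by (simp only: SH)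
    assume "v \<in> range H"
    then obtain y where y: "v = H y" by blast
    then have uv: "u + v = H (x + y)" by (simp add: x clinear_map_add[OF H(1)])
    show "u + v \<in> range H" unfolding uv by simp
    show "S \<cdot> (u + v) = S \<cdot> u + S \<cdot> v" unfolding uv unfolding x y by (simp only: SH)
  qed
  moreover have "densely_defined S"
  proof -
    have "Dom A \<subseteq> range H"
    proof
      fix u assume "u \<in> Dom A"
      then have "u = H (H (- (A \<cdot> u)))" using H(4) inverse_neg_eqI by simp
      then show "u \<in> range H" by blast
    qed
    then show ?thesis using dense_A closure_mono[of "Dom A" "range H"]
      by (auto simp: densely_defined_def DomS)
  qed
  ultimately have "self_adjoint_op S"
  proof (rule self_adjoint_opI)
    show "cinner (S \<cdot> u) v = cinner u (S \<cdot> v)" if "u \<in> Dom S" "v \<in> Dom S" for u v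
      using that by (auto simp: DomS SH csym)
    fix v w assume "\<And>u. u \<in> Dom S \<Longrightarrow> cinner (S \<cdot> u) v = cinner u w"
    \<comment> \<open>Elements of the domain are the \<open>H x\<close> with arbitrary
      \<open>x\<close>, so the adjoint relation becomes \<open>v = H w\<close>.\<close>
    then have "cinner x v = cinner x (H w)" for x using csym by (metis DomS SH rangeI)
    then have "cinner (v - H w) (v - H w) = 0" by (simp add: cinner_diff_right)
    then have "inner (v - H w) (v - H w) = 0" by (simp flip: Re_cinner)
    then show "v \<in> Dom S" by (simp add: DomS)
  qed
  moreover have "positive_op S"
    unfolding positive_op_def DomS using H(3) by (auto simp: SH Re_cinner inner_commute)
  moreover have "op_eq (op_comp S S) (op_neg A)"
    unfolding op_eq_def
  proof
    have "u \<in> Dom A \<longleftrightarrow> (\<exists>x. u = H (H x))" for u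
      using H(4) inverse_neg inverse_neg_eqI by metis
    moreover have "u \<in> Dom (op_comp S S) \<longleftrightarrow> (\<exists>x. u = H (H x))" for u
      using SH unfolding op_comp_def operator.sel DomS by force
    ultimately show dom: "Dom (op_comp S S) = Dom (op_neg A)"
      unfolding op_neg_def operator.sel by blast
    show "\<forall>u\<in>Dom (op_comp S S). op_comp S S \<cdot> u = op_neg A \<cdot> u"
    proof
      fix u assume "u \<in> Dom (op_comp S S)"
      then have "u \<in> Dom A" unfolding dom by (simp add: op_neg_def)
      then have "u = H (H (- (A \<cdot> u)))" using H(4) inverse_neg_eqI by simp
      then have "S \<cdot> (S \<cdot> u) = - (A \<cdot> u)" using SH by metis
      then show "op_comp S S \<cdot> u = op_neg A \<cdot> u" by (simp add: op_comp_def op_neg_def)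
    qed
  qed
  ultimately show ?thesis by blast
qed

definition neg_sqrt :: "'a operator" where "neg_sqrt = op_sqrt (op_neg A)"

lemma neg_sqrt: "self_adjoint_op neg_sqrt" "op_eq (op_comp neg_sqrt neg_sqrt) (op_neg A)"
  using someI_ex[OF sqrt_exists] by (auto simp: neg_sqrt_def op_sqrt_def)

lemma Dom_neg_sqrt_iff: "u \<in> Dom A \<longleftrightarrow> u \<in> Dom neg_sqrt \<and> neg_sqrt \<cdot> u \<in> Dom neg_sqrt"
  using neg_sqrt(2) by (auto simp: op_eq_def op_comp_def op_neg_def)

lemma neg_sqrt_square: "u \<in> Dom A \<Longrightarrow> neg_sqrt \<cdot> (neg_sqrt \<cdot> u) = - (A \<cdot> u)"
  using neg_sqrt(2) by (auto simp: op_eq_def op_comp_def op_neg_def)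

lemma neg_sqrt_sym: "u \<in> Dom neg_sqrt \<Longrightarrow> v \<in> Dom neg_sqrt \<Longrightarrow> inner (neg_sqrt \<cdot> u) v = inner u (neg_sqrt \<cdot> v)"
  using self_adjoint_sym[OF neg_sqrt(1)] by (metis Re_cinner)

lemma norm_neg_sqrt: "u \<in> Dom A \<Longrightarrow> (norm (neg_sqrt \<cdot> u))\<^sup>2 = inner (- (A \<cdot> u)) u"
  using neg_sqrt_sym[of "neg_sqrt \<cdot> u" u] neg_sqrt_square[of u] by (simp add: Dom_neg_sqrt_iff power2_norm_eq_inner)

text \<open>The root commutes with the inverse, so the inverse applied to
  \<open>neg_sqrt \<cdot> u\<close> still controls \<open>u\<close> itself. This links bounded
  energy to compactness.\<close>

lemma inverse_neg_neg_sqrt: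
  assumes "u \<in> Dom A"
  shows "inner (inverse_neg (neg_sqrt \<cdot> u)) (neg_sqrt \<cdot> u) = (norm u)\<^sup>2"
proof -
  let ?v = "inverse_neg u" and ?y = "neg_sqrt \<cdot> inverse_neg u"
  have v: "?v \<in> Dom A" "neg_sqrt \<cdot> ?y = u" using inverse_neg[of u] neg_sqrt_square by auto
  then have "?y \<in> Dom neg_sqrt" by (simp add: Dom_neg_sqrt_iff)
  moreover have "u \<in> Dom neg_sqrt" using assms Dom_neg_sqrt_iff by blast
  \<comment> \<open>The root maps \<open>?y\<close> to \<open>u\<close>, which is again in the
    domain of the root; this is membership of \<open>?y\<close> in \<open>Dom A\<close>.\<close>
  ultimately have y: "?y \<in> Dom A" using v Dom_neg_sqrt_iff by simp
  then have "- (A \<cdot> ?y) = neg_sqrt \<cdot> u" using neg_sqrt_square v by metis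
  then have "inverse_neg (neg_sqrt \<cdot> u) = ?y" using inverse_neg_eqI y by blast
  then show ?thesis
    using neg_sqrt_sym[OF \<open>?y \<in> Dom neg_sqrt\<close> \<open>u \<in> Dom neg_sqrt\<close>] v by (simp add: power2_norm_eq_inner)
qed

text \<open>Compactness is given at one point \<open>z\<close> only. The solution of
  \<open>- (A \<cdot> u) = f\<close> is also the resolvent at \<open>z\<close> applied to
  \<open>z *\<^sub>C u + f\<close>, and this new source is bounded along with
  \<open>f\<close>.\<close>

lemma inverse_neg_compact:
  assumes "compact_resolvent A" "\<And>n::nat. norm (f n) \<le> K"
  obtains r l where "strict_mono r" "(\<lambda>n. inverse_neg (f (r n))) \<longlonglongrightarrow> l"
proof -
  obtain z where z: "z \<in> resolvent_set UNIV A" "compact (closure (resolvent A z ` cball 0 1))"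
    using assms(1) by (auto simp: compact_resolvent_def)
  have "K \<ge> 0" using assms(2)[of 0] norm_ge_zero order_trans by blast
  \<comment> \<open>Bounds the norm of the new source, so that division by \<open>c\<close> brings
    it into the unit ball; the summand \<open>1\<close> keeps \<open>c\<close> positive.\<close>
  define c where "c = (cmod z + 1) * K + 1"
  have "c > 0" using \<open>K \<ge> 0\<close> by (simp add: c_def add_nonneg_pos)
  define u where "u n = (1 / c) *\<^sub>R inverse_neg (f n)" for n
  have "u n \<in> closure (resolvent A z ` cball 0 1)" for n
  proof -
    have u: "u n \<in> Dom A" by (simp add: u_def Dom_scaleR[OF lin_A] inverse_neg)
    have "- (A \<cdot> u n) = (1 / c) *\<^sub>R f n"
      using inverse_neg(2)[of "f n"] by (simp add: u_def linear_op_scaleR[OF lin_A] inverse_neg flip: scaleR_minus_right)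
    then have "A \<cdot> u n = - ((1 / c) *\<^sub>R f n)" by (metis minus_minus)
    then have eq: "z *\<^sub>C u n - A \<cdot> u n = (1 / c) *\<^sub>R (z *\<^sub>C inverse_neg (f n) + f n)"
      by (simp only:) (simp add: u_def scaleC_scaleR scaleR_add_right)
    have "norm (z *\<^sub>C inverse_neg (f n) + f n) \<le> cmod z * norm (f n) + norm (f n)"
      by (intro norm_triangle_le add_mono) (simp_all add: norm_scaleC norm_inverse_neg_le mult_left_mono)
    also have "\<dots> = (cmod z + 1) * norm (f n)" by (simp add: algebra_simps)
    also have "\<dots> \<le> (cmod z + 1) * K" by (intro mult_left_mono assms(2)) simp
    also have "\<dots> \<le> c" by (simp add: c_def)
    finally have "z *\<^sub>C u n - A \<cdot> u n \<in> cball 0 1"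
      using \<open>c > 0\<close> unfolding eq mem_cball_0 norm_scaleR by simp
    moreover have "resolvent A z (z *\<^sub>C u n - A \<cdot> u n) = u n"
      using z(1) u unfolding resolvent_def resolvent_set_def
      by (auto intro!: inv_into_f_f simp: bij_betw_def)
    ultimately show ?thesis by (metis closure_subset imageI subsetD)
  qed
  then obtain r l where r: "strict_mono r" "(u \<circ> r) \<longlonglongrightarrow> l"
    using z(2) by (metis compact_def)
  have "(\<lambda>n. c *\<^sub>R u (r n)) \<longlonglongrightarrow> c *\<^sub>R l"
    using r(2) by (intro tendsto_intros) (simp add: o_def)
  then show ?thesis using that[OF r(1)] \<open>c > 0\<close> by (simp add: u_def)
qed

text \<open>Bounded energy bounds \<open>neg_sqrt \<cdot> u n\<close>, so the inverse maps these
  vectors to a sequence with a convergent subsequence. By \<open>inverse_neg_neg_sqrt\<close> the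
  squared norm of a difference of the \<open>u n\<close> is at most \<open>2 * K\<close> times the
  norm of the corresponding difference of images, so the \<open>u n\<close> are Cauchy along it
  too.\<close>

lemma form_bounded_compact:
  assumes "compact_resolvent A" "\<And>n::nat. u n \<in> Dom A" "\<And>n. inner (- (A \<cdot> u n)) (u n) \<le> K\<^sup>2" "K \<ge> 0"
  obtains r l where "strict_mono r" "(\<lambda>n. u (r n)) \<longlonglongrightarrow> l"
proof -
  have bnd: "norm (neg_sqrt \<cdot> u n) \<le> K" for n
  proof (rule power2_le_imp_le)
    show "(norm (neg_sqrt \<cdot> u n))\<^sup>2 \<le> K\<^sup>2"
      unfolding norm_neg_sqrt[OF assms(2)] by (rule assms(3))
  qed (rule assms(4))
  obtain r l where r: "strict_mono r" "(\<lambda>n. inverse_neg (neg_sqrt \<cdot> u (r n))) \<longlonglongrightarrow> l"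
    using inverse_neg_compact[of "\<lambda>n. neg_sqrt \<cdot> u n" K, OF assms(1) bnd] by blast
  let ?w = "\<lambda>n. inverse_neg (neg_sqrt \<cdot> u (r n))"
  have lin_neg_sqrt: "linear_op neg_sqrt" using neg_sqrt(1) by (simp add: self_adjoint_op_def)
  have est: "(norm (u (r m) - u (r n)))\<^sup>2 \<le> 2 * K * norm (?w m - ?w n)" for m n
  proof -
    have d: "u (r m) - u (r n) \<in> Dom A" by (intro Dom_diff lin_A assms)
    have eq: "neg_sqrt \<cdot> (u (r m) - u (r n)) = neg_sqrt \<cdot> u (r m) - neg_sqrt \<cdot> u (r n)"
      using assms(2) by (intro linear_op_diff[OF lin_neg_sqrt]) (auto simp: Dom_neg_sqrt_iff)
    have "(norm (u (r m) - u (r n)))\<^sup>2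
        = inner (?w m - ?w n) (neg_sqrt \<cdot> u (r m) - neg_sqrt \<cdot> u (r n))"
      using inverse_neg_neg_sqrt[OF d] unfolding eq by (simp add: clinear_map_diff[OF inverse_neg_clinear])
    also have "\<dots> \<le> norm (?w m - ?w n) * norm (neg_sqrt \<cdot> u (r m) - neg_sqrt \<cdot> u (r n))"
      by (rule norm_cauchy_schwarz)
    also have "\<dots> \<le> norm (?w m - ?w n) * (2 * K)"
    proof (rule mult_left_mono)
      show "norm (neg_sqrt \<cdot> u (r m) - neg_sqrt \<cdot> u (r n)) \<le> 2 * K"
        using norm_triangle_ineq4[of "neg_sqrt \<cdot> u (r m)" "neg_sqrt \<cdot> u (r n)"] bnd[of "r m"] bnd[of "r n"] by linarith
    qed simp
    finally show ?thesis by (simp add: mult_ac)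
  qed
  have "Cauchy (\<lambda>n. u (r n))"
  proof (rule metric_CauchyI)
    fix e :: real assume "e > 0"
    have "Cauchy ?w" using r(2) LIMSEQ_imp_Cauchy by blast
    moreover have "e\<^sup>2 / (2 * K + 1) > 0" using \<open>e > 0\<close> assms(4) by simp
    ultimately obtain N where N: "\<forall>m\<ge>N. \<forall>n\<ge>N. dist (?w m) (?w n) < e\<^sup>2 / (2 * K + 1)"
      using metric_CauchyD by blast
    have "dist (u (r m)) (u (r n)) < e" if "m \<ge> N" "n \<ge> N" for m n
    proof -
      have "(norm (u (r m) - u (r n)))\<^sup>2 \<le> 2 * K * norm (?w m - ?w n)" by (rule est)
      also have "\<dots> \<le> (2 * K + 1) * norm (?w m - ?w n)" by (simp add: algebra_simps)
      also have "\<dots> < e\<^sup>2"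
        using N that assms(4) by (simp add: dist_norm field_simps)
      finally show ?thesis using \<open>e > 0\<close> by (simp add: dist_norm power_less_imp_less_base)
    qed
    then show "\<exists>N. \<forall>m\<ge>N. \<forall>n\<ge>N. dist (u (r m)) (u (r n)) < e" by blast
  qed
  then show ?thesis using that r(1) Cauchy_convergent convergent_def by blast
qed

end

section \<open>Orthogonal projections and perturbations\<close>

locale closed_csubspace =
  fixes N Y :: "'a::chilbert_space set"
  assumes N: "closed N" "csubspace N" and Y_def: "Y = orth_complement N"
begin

abbreviation Q :: "'a \<Rightarrow> 'a" where "Q \<equiv> orth_proj Y"

lemma csubspace_Y: "csubspace Y" and closed_Y: "closed Y"
  using csubspace_orth_complement closed_orth_complement[OF N(2)] by (simp_all add: Y_def)

lemma cinner_Y_N: "y \<in> Y \<Longrightarrow> n \<in> N \<Longrightarrow> cinner y n = 0"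
  by (simp add: Y_def orth_complement_def)

lemma cinner_N_Y: "y \<in> Y \<Longrightarrow> n \<in> N \<Longrightarrow> cinner n y = 0"
  using cinner_Y_N[of y n] cinner_commute[of n y] by simp

lemma Y_Int_N: "x \<in> Y \<Longrightarrow> x \<in> N \<Longrightarrow> x = 0"
  using cinner_Y_N[of x x] Re_cinner[of x x] by simp

lemma Q_eqI:
  assumes "y \<in> Y" "x - y \<in> N" shows "Q x = y"
  unfolding orth_proj_def
proof (rule the_equality)
  show "y \<in> Y \<and> x - y \<in> orth_complement Y"
    using assms cinner_N_Y by (auto simp: orth_complement_def)
  fix y' assume y': "y' \<in> Y \<and> x - y' \<in> orth_complement Y"
  then have d: "y' - y \<in> Y" using csubspace_diff[OF csubspace_Y] assms(1) by blast
  then have "cinner (x - y) (y' - y) = 0" "cinner (x - y') (y' - y) = 0"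
    using cinner_N_Y assms(2) y' by (auto simp: orth_complement_def)
  then have "cinner ((x - y) - (x - y')) (y' - y) = 0" by (simp only: cinner_diff_left) simp
  then have "inner (y' - y) (y' - y) = 0" by (simp flip: Re_cinner)
  then show "y' = y" by simp
qed

lemma Q_in: "Q x \<in> Y" and Q_compl: "x - Q x \<in> N"
proof -
  obtain n where n: "n \<in> N" "\<And>v. v \<in> N \<Longrightarrow> inner (x - n) v = 0"
    using orthogonal_projection_exists[OF N(1) csubspace_imp_subspace[OF N(2)]] by blast
  then have "x - n \<in> Y" using orth_complement_iff[OF N(2)] by (simp add: Y_def)
  with n(1) have "Q x = x - n" by (intro Q_eqI) auto
  with n(1) \<open>x - n \<in> Y\<close> show "Q x \<in> Y" "x - Q x \<in> N" by auto
qed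

lemma Q_add: "Q (x + y) = Q x + Q y"
proof (rule Q_eqI)
  show "Q x + Q y \<in> Y" using Q_in csubspace_Y by (simp add: csubspace_def)
  have "(x - Q x) + (y - Q y) \<in> N" using Q_compl N(2) by (simp add: csubspace_def del: diff_add_eq)
  then show "x + y - (Q x + Q y) \<in> N" by (simp add: algebra_simps)
qed

lemma Q_scaleC: "Q (c *\<^sub>C x) = c *\<^sub>C Q x"
proof (rule Q_eqI)
  show "c *\<^sub>C Q x \<in> Y" using Q_in csubspace_Y by (simp add: csubspace_def)
  have "c *\<^sub>C (x - Q x) \<in> N" using Q_compl N(2) by (simp add: csubspace_def)
  then show "c *\<^sub>C x - c *\<^sub>C Q x \<in> N" by (simp add: scaleC_diff_right)
qed

lemma clinear_Q: "clinear_map Q"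
  by (simp add: clinear_map_def Q_add Q_scaleC)

lemmas Q_diff = clinear_map_diff[OF clinear_Q]

lemma Q_id: "y \<in> Y \<Longrightarrow> Q y = y"
  using N(2) by (intro Q_eqI) (auto simp: csubspace_def)

lemma Q_zero: "n \<in> N \<Longrightarrow> Q n = 0"
  using csubspace_Y by (intro Q_eqI) (auto simp: csubspace_def)

lemma cinner_Q: "y \<in> Y \<Longrightarrow> cinner (Q x) y = cinner x y"
  using cinner_N_Y[OF _ Q_compl, of y x] by (simp add: cinner_diff_left)

lemma cinner_Q': "y \<in> Y \<Longrightarrow> cinner y (Q x) = cinner y x"
  using cinner_Q[of y x] cinner_commute by metis

lemma norm_Q_le: "norm (Q x) \<le> norm x" and norm_compl_le: "norm (x - Q x) \<le> norm x"
proof -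
  have "inner (Q x) (x - Q x) = 0" using cinner_Y_N[OF Q_in Q_compl] by (metis Re_cinner zero_complex.simps(1))
  then have "(norm x)\<^sup>2 = (norm (Q x))\<^sup>2 + (norm (x - Q x))\<^sup>2"
    by (simp add: power2_norm_eq_inner inner_simps inner_commute)
  then have "(norm (Q x))\<^sup>2 \<le> (norm x)\<^sup>2" "(norm (x - Q x))\<^sup>2 \<le> (norm x)\<^sup>2" by simp_all
  then show "norm (Q x) \<le> norm x" "norm (x - Q x) \<le> norm x"
    by (auto intro: power2_le_imp_le)
qed

end

lemma cinner_self: "cinner x x = complex_of_real ((norm x)\<^sup>2)"
  by (intro complex_eqI)
    (simp_all add: Re_cinner Im_cinner inner_scaleC_i_self power2_norm_eq_inner del: of_real_power)

text \<open>A Neumann-series argument relative to \<open>G\<close>: with \<open>s\<close> any choice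
  of preimages, the map taking \<open>g\<close> to \<open>f - K (s g)\<close> contracts by one half,
  and its fixed point gives the solution \<open>s g\<close>.\<close>

lemma perturbation_surj:
  fixes G K :: "'a::banach \<Rightarrow> 'a"
  assumes Y: "closed Y" "subspace Y" and D: "subspace D"
    and G: "\<And>u v. u \<in> D \<Longrightarrow> v \<in> D \<Longrightarrow> G (u - v) = G u - G v" "G ` D = Y"
    and K: "\<And>u v. u \<in> D \<Longrightarrow> v \<in> D \<Longrightarrow> K (u - v) = K u - K v" "K ` D \<subseteq> Y"
    and small: "\<And>u. u \<in> D \<Longrightarrow> norm (K u) \<le> norm (G u) / 2"
  shows "(\<lambda>u. G u + K u) ` D = Y"
proof
  show "(\<lambda>u. G u + K u) ` D \<subseteq> Y" using G(2) K(2) Y(2) by (auto intro: subspace_add)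
  show "Y \<subseteq> (\<lambda>u. G u + K u) ` D"
  proof
    fix f assume "f \<in> Y"
    have "\<forall>g\<in>Y. \<exists>u. u \<in> D \<and> G u = g" using G(2) by blast
    then obtain s where s: "\<And>g. g \<in> Y \<Longrightarrow> s g \<in> D" "\<And>g. g \<in> Y \<Longrightarrow> G (s g) = g" by metis
    have "\<exists>!g. g \<in> Y \<and> f - K (s g) = g"
    proof (rule Banach_fix[of Y "1/2"])
      show "complete Y" using Y(1) by (simp add: complete_eq_closed)
      show "Y \<noteq> {}" using \<open>f \<in> Y\<close> by blast
      show "(\<lambda>g. f - K (s g)) ` Y \<subseteq> Y"
        using s(1) K(2) \<open>f \<in> Y\<close> Y(2) by (auto intro!: subspace_diff)
      fix g h assume gh: "g \<in> Y" "h \<in> Y"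
      \<comment> \<open>The choice \<open>s\<close> carries no linearity; the estimate works because
        \<open>G\<close> maps the difference of the chosen preimages to
        \<open>g - h\<close>.\<close>
      have "dist (f - K (s g)) (f - K (s h)) = norm (K (s g - s h))"
        using K(1)[OF s(1)[OF gh(1)] s(1)[OF gh(2)]] by (simp add: dist_norm norm_minus_commute)
      also have "\<dots> \<le> norm (G (s g - s h)) / 2"
        by (intro small subspace_diff[OF D] s gh)
      also have "G (s g - s h) = g - h" using G(1)[OF s(1)[OF gh(1)] s(1)[OF gh(2)]] s(2) gh by simp
      finally show "dist (f - K (s g)) (f - K (s h)) \<le> 1/2 * dist g h" by (simp add: dist_norm)
    qed auto
    then obtain g where g: "g \<in> Y" "f - K (s g) = g" by blast
    then have "f = G (s g) + K (s g)" using s(2)[OF g(1)] by (simp add: algebra_simps)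
    then show "f \<in> (\<lambda>u. G u + K u) ` D" using s(1)[OF g(1)] by blast
  qed
qed

text \<open>Absorbs a linear term into a square: beyond the stated bound \<open>q\<close> exceeds 1,
  so \<open>b \<le> b * q\<close> and the square would be too large.\<close>

lemma quadratic_bound:
  fixes q a b :: real
  assumes "q\<^sup>2 \<le> a * q + b" "a \<ge> 0" "b \<ge> 0"
  shows "q \<le> a + b + 1"
proof (rule ccontr)
  assume "\<not> ?thesis"
  then have q: "q > a + b + 1" by simp
  have "a * q + b \<le> a * q + b * q" using q assms by (simp add: mult_le_cancel_left1)
  also have "\<dots> < (a + b + 1) * q" using q assms by (simp add: algebra_simps)
  also have "\<dots> \<le> q * q" using q assms by (intro mult_right_mono) auto
  finally show False using assms(1) by (simp add: power2_eq_square)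
qed

section \<open>Kernels and graphs of closed operators\<close>

lemma closed_Ker:
  assumes "closed_op T" shows "closed (Ker T)"
  unfolding closed_sequential_limits
proof (intro allI impI)
  fix x l assume xl: "(\<forall>n. x n \<in> Ker T) \<and> x \<longlonglongrightarrow> l"
  have "(\<lambda>n. (x n, 0)) \<longlonglongrightarrow> (l, 0 :: 'a)" using xl by (intro tendsto_Pair tendsto_const) simp
  moreover have "(x n, 0) \<in> {(u, T \<cdot> u) | u. u \<in> Dom T}" for n
  proof -
    have "x n \<in> Dom T" "T \<cdot> x n = 0" using xl by (auto simp: Ker_def)
    then show ?thesis by (auto intro: exI[of _ "x n"])
  qed
  ultimately have "(l, 0) \<in> {(u, T \<cdot> u) | u. u \<in> Dom T}"
    using closed_sequentially[of "{(u, T \<cdot> u) | u. u \<in> Dom T}" "\<lambda>n. (x n, 0)" "(l, 0)"] assms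
    unfolding closed_op_def by simp
  then show "l \<in> Ker T" by (auto simp: Ker_def)
qed

lemma csubspace_Ker: "linear_op T \<Longrightarrow> csubspace (Ker T)"
  by (auto simp: csubspace_def Ker_def linear_op_zero linear_op_add linear_op_scaleC Dom_add Dom_scaleC Dom_zero)

lemma subspace_graph:
  assumes "linear_op T" shows "subspace {(u, T \<cdot> u) | u. u \<in> Dom T}"
  unfolding subspace_def
proof (intro conjI ballI allI)
  show "0 \<in> {(u, T \<cdot> u) | u. u \<in> Dom T}"
    using Dom_zero[OF assms] linear_op_zero[OF assms] by (force simp: zero_prod_def)
qed (use assms in \<open>force simp: linear_op_add linear_op_scaleR Dom_add Dom_scaleR\<close>)+

text \<open>The graph is a closed subspace of the product space and hence weakly closed, so weak
  convergence of the images suffices.\<close>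

lemma closed_op_weak:
  assumes T: "linear_op T" "closed_op T" "\<And>n. u n \<in> Dom T"
    and "u \<longlonglongrightarrow> l" "\<And>z. (\<lambda>n. inner (T \<cdot> u n) z) \<longlonglongrightarrow> inner w z"
  shows "l \<in> Dom T" "T \<cdot> l = w"
proof -
  have "(l, w) \<in> {(u, T \<cdot> u) | u. u \<in> Dom T}"
  proof (rule closed_subspace_weakly_closed[OF _ subspace_graph[OF T(1)]])
    show "closed {(u, T \<cdot> u) | u. u \<in> Dom T}" using T(2) by (simp add: closed_op_def)
    show "(u n, T \<cdot> u n) \<in> {(u, T \<cdot> u) | u. u \<in> Dom T}" for n using T(3) by blast
    show "(\<lambda>n. inner (u n, T \<cdot> u n) z) \<longlonglongrightarrow> inner (l, w) z" for z
      unfolding inner_prod_def fst_conv snd_conv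
      by (intro tendsto_add tendsto_inner[OF assms(4) tendsto_const] assms(5))
  qed
  then show "l \<in> Dom T" "T \<cdot> l = w" by auto
qed

section \<open>Resolvent estimates\<close>

text \<open>In the application \<open>b\<close> is the action of \<open>B\<^sub>2\<close>; the identity
  \<open>\<langle>\<Lambda> u, b u\<rangle> \<in> \<real>\<close> is what remains of the factorization \<open>\<Lambda> = B\<^sub>1 B\<^sub>2\<close>.\<close>

locale symmetrized_operator =
  coercive_operator A + closed_csubspace "Ker \<Lambda>" Y
  for A \<Lambda> :: "'a::chilbert_space operator" and Y +
  fixes b :: "'a \<Rightarrow> 'a" and K C c D :: real
  assumes lin_\<Lambda>: "linear_op \<Lambda>" and closed_\<Lambda>: "closed_op \<Lambda>"
    and Q_Dom: "u \<in> Dom A \<Longrightarrow> Q u \<in> Dom A" and Q_A: "u \<in> Dom A \<Longrightarrow> A \<cdot> Q u = Q (A \<cdot> u)"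
    and Dom_\<Lambda>: "u \<in> Dom A \<Longrightarrow> u \<in> Dom \<Lambda>"
    and rel_bound: "u \<in> Dom A \<Longrightarrow> norm (\<Lambda> \<cdot> u) \<le> K * norm (A \<cdot> u)" and K: "K > 0"
    and form_bound: "u \<in> Dom A \<Longrightarrow>
      cmod (cinner (\<Lambda> \<cdot> u) u) + \<bar>Im (cinner (- (A \<cdot> u)) (\<Lambda> \<cdot> u))\<bar> \<le> C * inner (- (A \<cdot> u)) u"
    and C: "C > 0"
    and b_in: "u \<in> Dom A \<inter> Y \<Longrightarrow> b u \<in> Y"
    and b_self: "u \<in> Dom A \<Longrightarrow> Im (cinner u (b u)) = 0"
    and b_\<Lambda>: "u \<in> Dom A \<Longrightarrow> Im (cinner (\<Lambda> \<cdot> u) (b u)) = 0"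
    and b_bound: "u \<in> Dom A \<Longrightarrow> (norm (b u))\<^sup>2 \<le> D * inner (- (A \<cdot> u)) u" and D: "D > 0"
    and b_pos: "u \<in> Dom A \<inter> Y \<Longrightarrow> 0 \<le> inner u (b u)"
    and b_coercive: "u \<in> Dom A \<inter> Y \<Longrightarrow> c * inner (- (A \<cdot> u)) u \<le> inner (- (A \<cdot> u)) (b u)"
    and c: "c > 0"
begin

text \<open>The operator \<open>\<zeta> - Q L\<^sub>\<alpha>\<close> on
  \<open>Dom A \<inter> Y\<close>; there \<open>A \<cdot> u\<close> already lies in \<open>Y\<close>
  and stands in place of its projection.\<close>

definition G :: "complex \<Rightarrow> real \<Rightarrow> 'a \<Rightarrow> 'a" where
  "G \<zeta> \<alpha> u = \<zeta> *\<^sub>C u - A \<cdot> u + (\<i> * complex_of_real \<alpha>) *\<^sub>C Q (\<Lambda> \<cdot> u)"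

abbreviation E :: "'a \<Rightarrow> real" where "E u \<equiv> inner (- (A \<cdot> u)) u"

lemma subspace_D: "subspace (Dom A \<inter> Y)"
  using linear_op_csubspace[OF lin_A] csubspace_Y
  by (auto intro: csubspace_imp_subspace simp: csubspace_def)

lemma Q_A_id: "u \<in> Dom A \<inter> Y \<Longrightarrow> Q (A \<cdot> u) = A \<cdot> u"
  using Q_A[of u] Q_id[of u] by simp

lemma A_in: "u \<in> Dom A \<inter> Y \<Longrightarrow> A \<cdot> u \<in> Y"
  using Q_A_id Q_in by metis

lemma G_in: "u \<in> Dom A \<inter> Y \<Longrightarrow> G \<zeta> \<alpha> u \<in> Y"
  using A_in[of u] Q_in[of "\<Lambda> \<cdot> u"] csubspace_Y csubspace_diff[OF csubspace_Y]
  unfolding G_def csubspace_def by auto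

lemma QL_eq: "u \<in> Dom A \<inter> Y \<Longrightarrow> \<zeta> *\<^sub>C u - QL_op Y A \<Lambda> \<alpha> \<cdot> u = G \<zeta> \<alpha> u"
  by (simp add: QL_op_def G_def Q_A_id)

lemma G_diff:
  assumes "u \<in> Dom A" "v \<in> Dom A"
  shows "G \<zeta> \<alpha> (u - v) = G \<zeta> \<alpha> u - G \<zeta> \<alpha> v"
  using assms Dom_\<Lambda>
  by (simp add: G_def linear_op_diff[OF lin_A] linear_op_diff[OF lin_\<Lambda>] Q_diff scaleC_diff_right)

lemma G_scaleR: "u \<in> Dom A \<Longrightarrow> G \<zeta> \<alpha> (r *\<^sub>R u) = r *\<^sub>R G \<zeta> \<alpha> u"
  using Dom_\<Lambda>
  by (simp add: G_def linear_op_scaleR[OF lin_A] linear_op_scaleR[OF lin_\<Lambda>]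
      clinear_map_scaleR[OF clinear_Q] scaleC_scaleR algebra_simps)

lemma E_nonneg: "u \<in> Dom A \<Longrightarrow> 0 \<le> E u"
  using coercive order_trans zero_le_power2 by blast

lemma b_cinner_QL: "u \<in> Dom A \<inter> Y \<Longrightarrow> inner ((\<i> * complex_of_real \<alpha>) *\<^sub>C Q (\<Lambda> \<cdot> u)) (b u) = 0"
  using b_\<Lambda>[of u] cinner_Q[OF b_in, of u] by (simp flip: Re_cinner add: cinner_scaleC_left)

text \<open>The constant left when \<open>c * e \<le> n * sqrt (D * e)\<close>, with energy
  \<open>e\<close> and residual norm \<open>n\<close>, is divided by
  \<open>c * sqrt e\<close>.\<close>

definition C1 :: real where "C1 = sqrt D / c"

lemma C1: "C1 > 0" using D c by (simp add: C1_def)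

text \<open>In the pairing of \<open>G \<zeta> \<alpha> u\<close> with \<open>b u\<close> the shift
  contributes a nonnegative term, the coupling contributes nothing, and \<open>b_coercive\<close>
  bounds the rest from below. Since \<open>norm (b u)\<close> is controlled by the root of the
  energy, one such factor cancels.\<close>

lemma energy_estimate:
  assumes u: "u \<in> Dom A \<inter> Y" and \<zeta>: "Re \<zeta> \<ge> 0"
  shows "E u \<le> (C1 * norm (G \<zeta> \<alpha> u))\<^sup>2"
proof (cases "E u = 0")
  case False
  define e where "e = E u"
  have pos: "e > 0" using False E_nonneg u by (metis IntD1 order_le_less e_def)
  have "inner (\<zeta> *\<^sub>C u) (b u) = Re \<zeta> * inner u (b u)"
    using b_self[of u] u by (simp flip: Re_cinner add: cinner_scaleC_left)
  then have "c * e \<le> inner (\<zeta> *\<^sub>C u) (b u) + inner (- (A \<cdot> u)) (b u)"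
    using b_coercive[OF u] mult_nonneg_nonneg[OF \<zeta> b_pos[OF u]] unfolding e_def by linarith
  also have "\<dots> = inner (G \<zeta> \<alpha> u) (b u)"
    using b_cinner_QL[OF u, of \<alpha>] by (simp add: G_def inner_simps)
  also have "\<dots> \<le> norm (G \<zeta> \<alpha> u) * norm (b u)" by (rule norm_cauchy_schwarz)
  finally have "(c * e)\<^sup>2 \<le> (norm (G \<zeta> \<alpha> u) * norm (b u))\<^sup>2"
    using pos c by (intro power_mono) auto
  also have "\<dots> \<le> (norm (G \<zeta> \<alpha> u))\<^sup>2 * (D * e)"
    unfolding power_mult_distrib e_def using u by (intro mult_left_mono b_bound) auto
  finally have "c\<^sup>2 * e \<le> (norm (G \<zeta> \<alpha> u))\<^sup>2 * D"
    using pos by (simp add: power_mult_distrib power2_eq_square)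
  then have "e \<le> (C1 * norm (G \<zeta> \<alpha> u))\<^sup>2"
    using c D by (simp add: C1_def power_mult_distrib power_divide field_simps)
  then show ?thesis by (simp add: e_def)
qed simp

lemma norm_estimate:
  assumes "u \<in> Dom A \<inter> Y" "Re \<zeta> \<ge> 0"
  shows "norm u \<le> C1 * norm (G \<zeta> \<alpha> u)"
  using order_trans[OF coercive energy_estimate[OF assms]] assms(1) C1
  by (auto intro!: power2_le_imp_le)

text \<open>Imaginary part of the pairing with \<open>\<Lambda> \<cdot> u\<close>. The coupling
  produces \<alpha> times the squared projected norm; \<open>G \<zeta> \<alpha> u\<close> lies in
  \<open>Y\<close> and so sees only the projection; \<open>form_bound\<close> controls the two other
  terms.\<close>

lemma Lambda_estimate:
  assumes u: "u \<in> Dom A \<inter> Y"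
  shows "\<bar>\<alpha>\<bar> * (norm (Q (\<Lambda> \<cdot> u)))\<^sup>2
    \<le> norm (G \<zeta> \<alpha> u) * norm (Q (\<Lambda> \<cdot> u)) + (cmod \<zeta> + 1) * C * E u"
proof -
  let ?q = "norm (Q (\<Lambda> \<cdot> u))"
  have uA: "u \<in> Dom A" using u by simp
  have "cinner (Q (\<Lambda> \<cdot> u)) (\<Lambda> \<cdot> u) = complex_of_real (?q\<^sup>2)"
    using cinner_Q'[OF Q_in, of "\<Lambda> \<cdot> u" "\<Lambda> \<cdot> u"] by (simp only: cinner_self)
  then have "cinner (G \<zeta> \<alpha> u) (\<Lambda> \<cdot> u)
      = \<zeta> * cinner u (\<Lambda> \<cdot> u) + cinner (- (A \<cdot> u)) (\<Lambda> \<cdot> u) + \<i> * complex_of_real (\<alpha> * ?q\<^sup>2)"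
    by (simp add: G_def cinner_add_left cinner_diff_left cinner_minus_left cinner_scaleC_left)
  then have "\<alpha> * ?q\<^sup>2 = Im (cinner (G \<zeta> \<alpha> u) (\<Lambda> \<cdot> u)) - Im (\<zeta> * cinner u (\<Lambda> \<cdot> u))
      - Im (cinner (- (A \<cdot> u)) (\<Lambda> \<cdot> u))"
    by simp
  moreover have "\<bar>Im (cinner (G \<zeta> \<alpha> u) (\<Lambda> \<cdot> u))\<bar> \<le> norm (G \<zeta> \<alpha> u) * ?q"
    using cinner_Q'[OF G_in[OF u], of \<zeta> \<alpha> "\<Lambda> \<cdot> u"] cinner_le_norm[of "G \<zeta> \<alpha> u" "Q (\<Lambda> \<cdot> u)"]
      abs_Im_le_cmod[of "cinner (G \<zeta> \<alpha> u) (\<Lambda> \<cdot> u)"] by simp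
  moreover have "\<bar>Im (\<zeta> * cinner u (\<Lambda> \<cdot> u))\<bar> \<le> cmod \<zeta> * (C * E u)"
  proof -
    have "cmod (cinner u (\<Lambda> \<cdot> u)) \<le> C * E u"
      using form_bound[OF uA] cinner_commute[of u "\<Lambda> \<cdot> u"] by simp
    then have "cmod (\<zeta> * cinner u (\<Lambda> \<cdot> u)) \<le> cmod \<zeta> * (C * E u)"
      by (simp only: norm_mult mult_left_mono norm_ge_zero)
    then show ?thesis using abs_Im_le_cmod order_trans by blast
  qed
  moreover have "\<bar>Im (cinner (- (A \<cdot> u)) (\<Lambda> \<cdot> u))\<bar> \<le> C * E u"
  proof -
    have "0 \<le> cmod (cinner (\<Lambda> \<cdot> u) u)" by simp
    then show ?thesis using form_bound[OF uA] by linarith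
  qed
  moreover have "\<bar>\<alpha>\<bar> * ?q\<^sup>2 = \<bar>\<alpha> * ?q\<^sup>2\<bar>" by (simp add: abs_mult)
  moreover have "(cmod \<zeta> + 1) * C * E u = cmod \<zeta> * (C * E u) + C * E u"
    by (simp add: algebra_simps)
  ultimately show ?thesis by linarith
qed

text \<open>The constant must not depend on \<alpha>, so that continuation can use steps of one
  size. Small couplings are absorbed through the relative bound; for larger ones
  \<open>Lambda_estimate\<close> can be divided by \<open>\<bar>\<alpha>\<bar>\<close>.\<close>

lemma Lambda_uniform_bound:
  assumes \<zeta>: "Re \<zeta> \<ge> 0"
  obtains L where "L > 0" "\<And>\<alpha> u. u \<in> Dom A \<inter> Y \<Longrightarrow> norm (Q (\<Lambda> \<cdot> u)) \<le> L * norm (G \<zeta> \<alpha> u)"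
proof -
  \<comment> \<open>Chosen so that \<open>h * K = 1 / 2\<close>, which lets the coupling term be
    absorbed on the left.\<close>
  define h where "h = 1 / (2 * K)"
  define M where "M = (cmod \<zeta> + 1) * C * C1\<^sup>2"
  define L1 where "L1 = 1 + (1 + M) / h"
  define L2 where "L2 = K * (2 * (1 + cmod \<zeta> * C1))"
  have "h > 0" using K by (simp add: h_def)
  have "M > 0" using C C1 by (simp add: M_def add_nonneg_pos)
  have "L1 \<ge> 1" using \<open>h > 0\<close> \<open>M > 0\<close> by (simp add: L1_def)
  have "L2 > 0" using K C1 by (simp add: L2_def add_pos_nonneg)
  have "norm (Q (\<Lambda> \<cdot> u)) \<le> max L1 L2 * norm (G \<zeta> \<alpha> u)" if u: "u \<in> Dom A \<inter> Y" for \<alpha> u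
  proof (cases "\<bar>\<alpha>\<bar> \<le> h")
    case True
    let ?F = "norm (G \<zeta> \<alpha> u)"
    have q: "norm (Q (\<Lambda> \<cdot> u)) \<le> K * norm (A \<cdot> u)"
      using norm_Q_le rel_bound[of u] u order_trans by blast
    have "A \<cdot> u = \<zeta> *\<^sub>C u + (\<i> * complex_of_real \<alpha>) *\<^sub>C Q (\<Lambda> \<cdot> u) - G \<zeta> \<alpha> u"
      by (simp add: G_def)
    then have "norm (A \<cdot> u) \<le> norm (\<zeta> *\<^sub>C u + (\<i> * complex_of_real \<alpha>) *\<^sub>C Q (\<Lambda> \<cdot> u)) + ?F"
      by (metis norm_triangle_ineq4)
    also have "\<dots> \<le> (cmod \<zeta> * norm u + \<bar>\<alpha>\<bar> * norm (Q (\<Lambda> \<cdot> u))) + ?F"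
      by (intro add_mono order.refl order_trans[OF norm_triangle_ineq]) (simp_all add: norm_scaleC norm_mult)
    also have "\<dots> \<le> (cmod \<zeta> * (C1 * ?F) + h * (K * norm (A \<cdot> u))) + ?F"
      using True \<open>h > 0\<close> by (intro add_mono mult_left_mono mult_mono order.refl norm_estimate[OF u \<zeta>] q) auto
    also have "h * (K * norm (A \<cdot> u)) = norm (A \<cdot> u) / 2" using K by (simp add: h_def)
    finally have "norm (A \<cdot> u) \<le> 2 * (1 + cmod \<zeta> * C1) * ?F" by (simp add: algebra_simps)
    then have "K * norm (A \<cdot> u) \<le> K * (2 * (1 + cmod \<zeta> * C1) * ?F)"
      using K by (intro mult_left_mono) auto
    then have "norm (Q (\<Lambda> \<cdot> u)) \<le> L2 * ?F" using q by (simp add: L2_def mult_ac)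
    also have "\<dots> \<le> max L1 L2 * ?F" by (intro mult_right_mono) auto
    finally show ?thesis .
  next
    case False
    let ?F = "norm (G \<zeta> \<alpha> u)" and ?q = "norm (Q (\<Lambda> \<cdot> u))"
    have "?q \<le> L1 * ?F"
    proof (rule ccontr)
      assume "\<not> ?thesis"
      then have q: "?q > L1 * ?F" by simp
      then have "?q > 0" using \<open>L1 \<ge> 1\<close>
        by (metis mult_nonneg_nonneg norm_ge_zero order_le_less_trans order_trans zero_le_one)
      \<comment> \<open>Once \<open>?F \<le> ?q\<close> is known, one factor of the term quadratic
        in \<open>?F\<close> can be traded for \<open>?q\<close>, and then a factor
        \<open>?q\<close> cancels throughout.\<close>
      have "1 * ?F \<le> L1 * ?F" using \<open>L1 \<ge> 1\<close> by (intro mult_right_mono) auto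
      then have "?F \<le> ?q" using q by linarith
      have "h * ?q\<^sup>2 \<le> \<bar>\<alpha>\<bar> * ?q\<^sup>2" using False by (intro mult_right_mono) auto
      also have "\<dots> \<le> ?F * ?q + (cmod \<zeta> + 1) * C * E u" by (rule Lambda_estimate[OF u])
      also have "\<dots> \<le> ?F * ?q + (cmod \<zeta> + 1) * C * (C1 * ?F)\<^sup>2"
        using C by (intro add_left_mono mult_left_mono energy_estimate[OF u \<zeta>]) auto
      also have "\<dots> = ?F * ?q + M * ?F * ?F" by (simp add: M_def power_mult_distrib power2_eq_square)
      also have "\<dots> \<le> ?F * ?q + M * ?F * ?q"
        using \<open>M > 0\<close> \<open>?F \<le> ?q\<close> by (intro add_left_mono mult_left_mono) auto
      also have "\<dots> = (1 + M) * ?F * ?q" by (simp add: algebra_simps)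
      finally have "h * ?q \<le> (1 + M) * ?F" using \<open>?q > 0\<close> by (simp add: power2_eq_square)
      then have "?q \<le> (1 + M) / h * ?F" using \<open>h > 0\<close> by (simp add: field_simps)
      also have "\<dots> \<le> L1 * ?F" unfolding L1_def by (intro mult_right_mono) auto
      finally show False using q by simp
    qed
    also have "\<dots> \<le> max L1 L2 * ?F" by (intro mult_right_mono) auto
    finally show ?thesis .
  qed
  moreover have "max L1 L2 > 0" using \<open>L2 > 0\<close> by simp
  ultimately show ?thesis using that by blast
qed

section \<open>Solvability on the right half plane and in a strip to its left\<close>

lemma G_zero_surj:
  assumes "Re \<zeta> \<ge> 0" shows "G \<zeta> 0 ` (Dom A \<inter> Y) = Y"
proof
  show "G \<zeta> 0 ` (Dom A \<inter> Y) \<subseteq> Y" using G_in by blast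
  show "Y \<subseteq> G \<zeta> 0 ` (Dom A \<inter> Y)"
  proof
    fix f assume f: "f \<in> Y"
    obtain u where u: "u \<in> Dom A" "\<zeta> *\<^sub>C u - A \<cdot> u = f" using shift_surj[of \<zeta> f] assms by auto
    then have "\<zeta> *\<^sub>C Q u - A \<cdot> Q u = f"
      using Q_id[OF f] by (auto simp: Q_A Q_diff Q_scaleC)
    then have "f = G \<zeta> 0 (Q u)" by (simp add: G_def)
    then show "f \<in> G \<zeta> 0 ` (Dom A \<inter> Y)" using Q_Dom[OF u(1)] Q_in by blast
  qed
qed

text \<open>Continuation in the coupling parameter, from \<open>0\<close> to \<open>\<alpha>\<close> in steps of fixed size.\<close>

lemma G_surj:
  assumes \<zeta>: "Re \<zeta> \<ge> 0" shows "G \<zeta> \<alpha> ` (Dom A \<inter> Y) = Y"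
proof -
  obtain L where L: "L > 0" "\<And>\<alpha> u. u \<in> Dom A \<inter> Y \<Longrightarrow> norm (Q (\<Lambda> \<cdot> u)) \<le> L * norm (G \<zeta> \<alpha> u)"
    using Lambda_uniform_bound[OF \<zeta>] by blast
  \<comment> \<open>The added \<open>1\<close> makes \<open>N\<close> positive; the rest keeps each
    step \<open>h\<close> at most \<open>1 / (2 * L)\<close> in size.\<close>
  obtain N :: nat where "real N \<ge> 2 * L * \<bar>\<alpha>\<bar> + 1" using real_arch_simple by blast
  moreover have "2 * L * \<bar>\<alpha>\<bar> \<ge> 0" using L(1) by simp
  ultimately have N: "N > 0" "2 * L * \<bar>\<alpha>\<bar> \<le> real N" by (auto simp: not_le intro: gr0I)
  define h where "h = \<alpha> / real N"
  have h: "\<bar>h\<bar> * L \<le> 1 / 2" using N by (simp add: h_def field_simps)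
  have "G \<zeta> (real k * h) ` (Dom A \<inter> Y) = Y" for k
  proof (induction k)
    case 0
    show ?case using G_zero_surj[OF \<zeta>] by simp
  next
    case (Suc k)
    let ?P = "\<lambda>u. (\<i> * complex_of_real h) *\<^sub>C Q (\<Lambda> \<cdot> u)"
    have "(\<lambda>u. G \<zeta> (real k * h) u + ?P u) ` (Dom A \<inter> Y) = Y"
    proof (rule perturbation_surj[OF closed_Y csubspace_imp_subspace[OF csubspace_Y] subspace_D _ Suc])
      show "G \<zeta> (real k * h) (u - v) = G \<zeta> (real k * h) u - G \<zeta> (real k * h) v"
        if "u \<in> Dom A \<inter> Y" "v \<in> Dom A \<inter> Y" for u v using that by (intro G_diff) auto
      show "?P (u - v) = ?P u - ?P v" if "u \<in> Dom A \<inter> Y" "v \<in> Dom A \<inter> Y" for u v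
        using that Dom_\<Lambda> by (simp add: linear_op_diff[OF lin_\<Lambda>] Q_diff scaleC_diff_right)
      show "?P ` (Dom A \<inter> Y) \<subseteq> Y" using Q_in csubspace_Y by (auto simp: csubspace_def)
      fix u assume u: "u \<in> Dom A \<inter> Y"
      have "norm (?P u) = \<bar>h\<bar> * norm (Q (\<Lambda> \<cdot> u))" by (simp add: norm_scaleC norm_mult)
      also have "\<dots> \<le> \<bar>h\<bar> * (L * norm (G \<zeta> (real k * h) u))"
        by (intro mult_left_mono L(2) u) simp
      also have "\<dots> \<le> 1 / 2 * norm (G \<zeta> (real k * h) u)"
        unfolding mult.assoc[symmetric] by (intro mult_right_mono h) simp
      finally show "norm (?P u) \<le> norm (G \<zeta> (real k * h) u) / 2" by simp
    qed
    moreover have "G \<zeta> (real k * h) u + ?P u = G \<zeta> (real (Suc k) * h) u" for u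
      by (simp add: G_def distrib_right distrib_left scaleC_add_left)
    ultimately show ?case by simp
  qed
  from this[of N] show ?thesis using N by (simp add: h_def)
qed

lemma in_resolvent_setI:
  assumes "G \<zeta> \<alpha> ` (Dom A \<inter> Y) = Y" "\<And>u. u \<in> Dom A \<inter> Y \<Longrightarrow> norm u \<le> M * norm (G \<zeta> \<alpha> u)"
  shows "\<zeta> \<in> resolvent_set Y (QL_op Y A \<Lambda> \<alpha>)"
proof -
  have D: "Dom (QL_op Y A \<Lambda> \<alpha>) = Dom A \<inter> Y" by (simp add: QL_op_def)
  have "inj_on (G \<zeta> \<alpha>) (Dom A \<inter> Y)"
  proof (rule inj_onI)
    fix u v assume uv: "u \<in> Dom A \<inter> Y" "v \<in> Dom A \<inter> Y" "G \<zeta> \<alpha> u = G \<zeta> \<alpha> v"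
    then have "G \<zeta> \<alpha> (u - v) = 0" by (simp add: G_diff)
    then show "u = v" using assms(2)[OF subspace_diff[OF subspace_D uv(1,2)]] by simp
  qed
  then have "bij_betw (G \<zeta> \<alpha>) (Dom A \<inter> Y) Y" using assms(1) by (simp add: bij_betw_def)
  then have "bij_betw (\<lambda>u. \<zeta> *\<^sub>C u - QL_op Y A \<Lambda> \<alpha> \<cdot> u) (Dom A \<inter> Y) Y"
    by (subst bij_betw_cong[OF QL_eq])
  then show ?thesis
    using assms(2) unfolding resolvent_set_def D by (auto simp: QL_eq)
qed

lemma right_half_plane:
  "Re \<zeta> \<ge> 0 \<Longrightarrow> \<zeta> \<in> resolvent_set Y (QL_op Y A \<Lambda> \<alpha>)"
  by (rule in_resolvent_setI[OF G_surj norm_estimate])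

text \<open>A horizontal move from the imaginary axis: the shift by \<open>Re \<zeta>\<close> costs
  at most \<open>M * \<epsilon>\<close>, hence at most one half, relative to \<open>G\<close> on the
  axis.\<close>

lemma left_strip:
  assumes est: "\<And>l u. u \<in> Dom A \<inter> Y \<Longrightarrow> norm u \<le> \<epsilon> * norm (G (\<i> * complex_of_real l) \<alpha> u)"
    and \<epsilon>: "\<epsilon> \<ge> 0" "\<epsilon> * M \<le> 1 / 2" and \<zeta>: "Re \<zeta> \<ge> - M"
  shows "\<zeta> \<in> resolvent_set Y (QL_op Y A \<Lambda> \<alpha>)"
proof (cases "Re \<zeta> \<ge> 0")
  case True
  then show ?thesis by (rule right_half_plane)
next
  case False
  let ?z = "\<i> * complex_of_real (Im \<zeta>)" and ?P = "\<lambda>u. complex_of_real (Re \<zeta>) *\<^sub>C u"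
  have eq: "G ?z \<alpha> u + ?P u = G \<zeta> \<alpha> u" for u
  proof -
    have "\<zeta> *\<^sub>C u = ?z *\<^sub>C u + ?P u"
      by (simp flip: scaleC_add_left add: complex_eq[symmetric] add.commute)
    then show ?thesis by (simp add: G_def)
  qed
  have small: "norm (?P u) \<le> norm (G ?z \<alpha> u) / 2" if u: "u \<in> Dom A \<inter> Y" for u
  proof -
    have "norm (?P u) = \<bar>Re \<zeta>\<bar> * norm u" by (simp add: norm_scaleC)
    also have "\<dots> \<le> M * (\<epsilon> * norm (G ?z \<alpha> u))"
      using False \<zeta> by (intro mult_mono est u) auto
    also have "\<dots> = (\<epsilon> * M) * norm (G ?z \<alpha> u)" by simp
    also have "\<dots> \<le> 1 / 2 * norm (G ?z \<alpha> u)" by (intro mult_right_mono \<epsilon>) simp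
    finally show ?thesis by simp
  qed
  have "(\<lambda>u. G ?z \<alpha> u + ?P u) ` (Dom A \<inter> Y) = Y"
  proof (rule perturbation_surj[OF closed_Y csubspace_imp_subspace[OF csubspace_Y] subspace_D])
    show "G ?z \<alpha> (u - v) = G ?z \<alpha> u - G ?z \<alpha> v"
      if "u \<in> Dom A \<inter> Y" "v \<in> Dom A \<inter> Y" for u v using that by (intro G_diff) auto
    show "G ?z \<alpha> ` (Dom A \<inter> Y) = Y" by (rule G_surj) simp
    show "?P ` (Dom A \<inter> Y) \<subseteq> Y" using csubspace_Y by (auto simp: csubspace_def)
  qed (use small in \<open>auto simp: scaleC_diff_right\<close>)
  then have surj: "G \<zeta> \<alpha> ` (Dom A \<inter> Y) = Y" unfolding eq .
  show ?thesis
  \<comment> \<open>The perturbation at worst halves the lower bound, which doubles the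
    constant.\<close>
  proof (rule in_resolvent_setI[OF surj, of "2 * \<epsilon>"])
    fix u assume u: "u \<in> Dom A \<inter> Y"
    have "norm (G ?z \<alpha> u) \<le> norm (G \<zeta> \<alpha> u) + norm (?P u)"
      using norm_triangle_ineq4[of "G \<zeta> \<alpha> u" "?P u"] by (simp flip: eq)
    then have "norm (G ?z \<alpha> u) \<le> 2 * norm (G \<zeta> \<alpha> u)" using small[OF u] by simp
    then have "\<epsilon> * norm (G ?z \<alpha> u) \<le> \<epsilon> * (2 * norm (G \<zeta> \<alpha> u))" using \<epsilon> by (intro mult_left_mono)
    then show "norm u \<le> 2 * \<epsilon> * norm (G \<zeta> \<alpha> u)"
      using est[OF u, of "Im \<zeta>"] by simp
  qed
qed

end

section \<open>Exclusion of quasimodes for large coupling\<close>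

locale pseudospectral_setting = symmetrized_operator +
  assumes comp: "compact_resolvent A"
    and Ker_adjoint: "Ker \<Lambda> \<subseteq> Dom (adjoint_op \<Lambda>)"
    and Ker_Ran: "Ker \<Lambda> \<inter> Ran \<Lambda> = {0}"
    and no_eigenvalue: "r \<noteq> 0 \<Longrightarrow> \<not> eigenvalue \<Lambda> (complex_of_real r)"
begin

text \<open>The components of \<open>\<Lambda> u\<close> along the kernel are \<open>\<langle>u, \<Lambda>\<^sup>* v\<rangle>\<close> with \<open>v \<in> Ker \<Lambda>\<close>, hence
  bounded for each \<open>v\<close>; uniform boundedness does the rest.\<close>

lemma compl_Lambda_bounded:
  obtains K' where "K' \<ge> 0" "\<And>u. u \<in> Dom \<Lambda> \<Longrightarrow> norm (\<Lambda> \<cdot> u - Q (\<Lambda> \<cdot> u)) \<le> K' * norm u"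
proof -
  let ?P = "\<lambda>x. x - Q x"
  have sym: "cinner (?P x) v = cinner x (?P v)" for x v
    using cinner_Q[OF Q_in, of x v] cinner_Q'[OF Q_in, of x v]
    by (simp add: cinner_diff_left cinner_diff_right)
  have "\<exists>M. \<forall>b \<in> {?P (\<Lambda> \<cdot> u) | u. u \<in> Dom \<Lambda> \<and> norm u \<le> 1}. \<bar>inner b v\<bar> \<le> M" for v
  proof -
    obtain w where w: "\<And>u. u \<in> Dom \<Lambda> \<Longrightarrow> cinner (\<Lambda> \<cdot> u) (?P v) = cinner u w"
      using Ker_adjoint Q_compl[of v] by (auto simp: adjoint_op_def)
    have "\<bar>inner (?P (\<Lambda> \<cdot> u)) v\<bar> \<le> norm w" if "u \<in> Dom \<Lambda>" "norm u \<le> 1" for u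
    proof -
      have "inner (?P (\<Lambda> \<cdot> u)) v = inner u w"
        using sym w[OF that(1)] by (simp flip: Re_cinner)
      then have "\<bar>inner (?P (\<Lambda> \<cdot> u)) v\<bar> \<le> norm u * norm w"
        using Cauchy_Schwarz_ineq2[of u w] by (simp only:)
      also have "\<dots> \<le> 1 * norm w" by (intro mult_right_mono that) simp
      finally show ?thesis by simp
    qed
    then show ?thesis by blast
  qed
  then obtain M where M: "\<forall>b \<in> {?P (\<Lambda> \<cdot> u) | u. u \<in> Dom \<Lambda> \<and> norm u \<le> 1}. norm b \<le> M"
    using uniform_boundedness by meson
  have "norm (?P (\<Lambda> \<cdot> u)) \<le> max M 0 * norm u" if u: "u \<in> Dom \<Lambda>" for u
  proof (cases "u = 0")
    case True
    then show ?thesis using linear_op_zero[OF lin_\<Lambda>] Q_zero[of 0] Dom_zero[OF lin_\<Lambda>]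
      by (simp add: Ker_def)
  next
    case False
    let ?v = "(1 / norm u) *\<^sub>R u"
    have v: "?v \<in> Dom \<Lambda>" "norm ?v \<le> 1" using False Dom_scaleR[OF lin_\<Lambda> u] by auto
    have "?P (\<Lambda> \<cdot> ?v) = (1 / norm u) *\<^sub>R ?P (\<Lambda> \<cdot> u)"
      by (simp add: linear_op_scaleR[OF lin_\<Lambda> u] clinear_map_scaleR[OF clinear_Q] scaleR_diff_right)
    moreover have "norm (?P (\<Lambda> \<cdot> ?v)) \<le> M" using M v by blast
    ultimately have "norm ((1 / norm u) *\<^sub>R ?P (\<Lambda> \<cdot> u)) \<le> M" by (simp only:)
    then have "norm (?P (\<Lambda> \<cdot> u)) \<le> M * norm u"
      using False unfolding norm_scaleR by (simp add: divide_le_eq)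
    also have "\<dots> \<le> max M 0 * norm u" by (intro mult_right_mono) auto
    finally show ?thesis .
  qed
  then show ?thesis using that[of "max M 0"] by simp
qed

text \<open>A normalized limit of quasimodes as \<open>|\<alpha>| \<rightarrow> \<infinity>\<close> would satisfy this equation.\<close>

lemma no_limit_mode:
  assumes "l \<in> Dom \<Lambda>" "l \<in> Y" "p \<in> Ker \<Lambda>" "\<Lambda> \<cdot> l = p - \<rho> *\<^sub>R l"
  shows "l = 0"
proof (cases "\<rho> = 0")
  case True
  then have "p \<in> Ran \<Lambda>" using assms(1,4) by (force simp: Ran_def)
  then have "p = 0" using Ker_Ran assms(3) by blast
  then have "l \<in> Ker \<Lambda>" using assms True by (simp add: Ker_def)
  then show ?thesis using Y_Int_N assms(2) by blast
next
  case False
  define v where "v = p - \<rho> *\<^sub>R l"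
  have v: "v \<in> Dom \<Lambda>" unfolding v_def
    using assms(1,3) by (intro Dom_diff lin_\<Lambda> Dom_scaleR) (auto simp: Ker_def)
  have "\<Lambda> \<cdot> v = \<Lambda> \<cdot> p - \<rho> *\<^sub>R (\<Lambda> \<cdot> l)"
    unfolding v_def using assms(1,3) Dom_scaleR[OF lin_\<Lambda>]
    by (simp add: linear_op_diff[OF lin_\<Lambda>] linear_op_scaleR[OF lin_\<Lambda>] Ker_def)
  also have "\<dots> = complex_of_real (- \<rho>) *\<^sub>C v"
    unfolding scaleC_of_real using assms(3,4) by (simp add: Ker_def v_def)
  finally have "v = 0"
    using no_eigenvalue[of "- \<rho>"] False v by (auto simp: eigenvalue_def)
  then have "l = (1 / \<rho>) *\<^sub>R p" using False by (simp add: v_def)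
  then have "l \<in> Ker \<Lambda>" using csubspace_scaleR[OF N(2) assms(3)] by simp
  then show ?thesis using Y_Int_N assms(2) by blast
qed

text \<open>Pair with \<open>u\<close> itself and take imaginary parts:
  \<open>cinner (A \<cdot> u) u\<close> is real, so only \<open>l\<close> and the coupling survive.
  Frequencies of quasimodes with bounded energy thus grow at most linearly in
  \<open>\<bar>\<alpha>\<bar>\<close>.\<close>

lemma frequency_bound:
  assumes u: "u \<in> Dom A \<inter> Y" "norm u = 1"
  shows "\<bar>l\<bar> \<le> norm (G (\<i> * complex_of_real l) \<alpha> u) + \<bar>\<alpha>\<bar> * (C * E u)"
proof -
  let ?g = "G (\<i> * complex_of_real l) \<alpha> u"
  have uA: "u \<in> Dom A" using u by simp
  have "Im (cinner (A \<cdot> u) u) = 0"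
    using self_adjoint_sym[OF self_adjoint uA uA] cinner_commute[of u "A \<cdot> u"]
    by (simp add: complex_eq_iff)
  moreover have "cinner (Q (\<Lambda> \<cdot> u)) u = cinner (\<Lambda> \<cdot> u) u" using cinner_Q u by simp
  ultimately have "Im (cinner ?g u) = l + \<alpha> * Re (cinner (\<Lambda> \<cdot> u) u)"
    using u(2) by (simp add: G_def cinner_add_left cinner_diff_left cinner_scaleC_left cinner_self)
  moreover have "\<bar>Im (cinner ?g u)\<bar> \<le> norm ?g"
    using abs_Im_le_cmod[of "cinner ?g u"] cinner_le_norm[of ?g u] u(2) by simp
  moreover have "\<bar>\<alpha> * Re (cinner (\<Lambda> \<cdot> u) u)\<bar> \<le> \<bar>\<alpha>\<bar> * (C * E u)"
  proof -
    have "\<bar>Re (cinner (\<Lambda> \<cdot> u) u)\<bar> \<le> C * E u"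
      using form_bound[OF uA] abs_Re_le_cmod[of "cinner (\<Lambda> \<cdot> u) u"] by linarith
    then show ?thesis unfolding abs_mult by (rule mult_left_mono) simp
  qed
  ultimately show ?thesis by linarith
qed

lemma decay_estimate:
  assumes "\<epsilon> > 0"
  shows "\<exists>a. \<forall>\<alpha>. \<bar>\<alpha>\<bar> \<ge> a \<longrightarrow> (\<forall>l. \<forall>u\<in>Dom A \<inter> Y. norm u \<le> \<epsilon> * norm (G (\<i> * complex_of_real l) \<alpha> u))"
proof (rule ccontr)
  assume contr: "\<not> ?thesis"
  \<comment> \<open>The negated claim with threshold \<open>Suc n\<close>, after normalization; the
    successor also gives \<open>\<bar>\<alpha>\<bar> \<ge> 1\<close>, so division is safe.\<close>
  have "\<exists>\<alpha> l u. \<bar>\<alpha>\<bar> \<ge> real (Suc n) \<and> u \<in> Dom A \<inter> Y \<and> norm u = 1 \<and>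
      norm (G (\<i> * complex_of_real l) \<alpha> u) \<le> 1 / \<epsilon>" for n
  proof -
    obtain \<alpha> l u where *: "\<bar>\<alpha>\<bar> \<ge> real (Suc n)" "u \<in> Dom A \<inter> Y"
      "norm u > \<epsilon> * norm (G (\<i> * complex_of_real l) \<alpha> u)"
      using contr by (force simp: not_le)
    have "norm u > 0" using *(3) assms by (metis mult_nonneg_nonneg norm_ge_zero order_le_less_trans less_imp_le)
    let ?v = "(1 / norm u) *\<^sub>R u"
    have "?v \<in> Dom A \<inter> Y" using *(2) subspace_scale[OF subspace_D] by blast
    moreover have "norm ?v = 1" using \<open>norm u > 0\<close> by simp
    moreover have "norm (G (\<i> * complex_of_real l) \<alpha> ?v) \<le> 1 / \<epsilon>"
      using *(2,3) \<open>norm u > 0\<close> assms by (simp add: G_scaleR field_simps)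
    ultimately show ?thesis using *(1) by blast
  qed
  then obtain \<alpha>0 l0 u0 where seq: "\<And>n. \<bar>\<alpha>0 n\<bar> \<ge> real (Suc n)" "\<And>n. u0 n \<in> Dom A \<inter> Y"
    "\<And>n. norm (u0 n) = 1" "\<And>n. norm (G (\<i> * complex_of_real (l0 n)) (\<alpha>0 n) (u0 n)) \<le> 1 / \<epsilon>"
    by metis
  have E0: "E (u0 n) \<le> (C1 / \<epsilon>)\<^sup>2" for n
  proof -
    have "E (u0 n) \<le> (C1 * norm (G (\<i> * complex_of_real (l0 n)) (\<alpha>0 n) (u0 n)))\<^sup>2"
      by (rule energy_estimate[OF seq(2)]) simp
    also have "\<dots> \<le> (C1 * (1 / \<epsilon>))\<^sup>2"
      using C1 by (intro power_mono mult_left_mono seq(4)) auto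
    finally show ?thesis by simp
  qed
  \<comment> \<open>The bound for \<open>l0 n / \<alpha>0 n\<close> that
    \<open>frequency_bound\<close> yields; its residual term uses
    \<open>\<bar>\<alpha>0 n\<bar> \<ge> 1\<close>.\<close>
  define R where "R = 1 / \<epsilon> + C * (C1 / \<epsilon>)\<^sup>2"
  have \<alpha>_pos: "\<bar>\<alpha>0 n\<bar> \<ge> 1" for n using seq(1)[of n] by simp
  have \<rho>0: "\<bar>l0 n / \<alpha>0 n\<bar> \<le> R" for n
  proof -
    have "\<bar>l0 n\<bar> \<le> 1 / \<epsilon> + \<bar>\<alpha>0 n\<bar> * (C * (C1 / \<epsilon>)\<^sup>2)"
      using frequency_bound[OF seq(2)[of n] seq(3)[of n], of "l0 n" "\<alpha>0 n"] seq(4)[of n]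
        mult_left_mono[OF mult_left_mono[OF E0[of n], of C], of "\<bar>\<alpha>0 n\<bar>"] C by linarith
    also have "\<dots> \<le> \<bar>\<alpha>0 n\<bar> * (1 / \<epsilon>) + \<bar>\<alpha>0 n\<bar> * (C * (C1 / \<epsilon>)\<^sup>2)"
      using \<alpha>_pos[of n] assms mult_right_mono[of 1 "\<bar>\<alpha>0 n\<bar>" "1 / \<epsilon>"] by simp
    also have "\<dots> = R * \<bar>\<alpha>0 n\<bar>" by (simp add: R_def algebra_simps)
    finally show ?thesis using \<alpha>_pos[of n] by (simp add: field_simps abs_divide)
  qed
  \<comment> \<open>Two successive extractions: bounded energy gives a strong limit of the modes,
    boundedness a limit of the frequency ratios.\<close>
  obtain r1 x where r1: "strict_mono r1" "(\<lambda>n. u0 (r1 n)) \<longlonglongrightarrow> x"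
    using form_bounded_compact[of u0 "C1 / \<epsilon>", OF comp _ E0] seq(2) C1 assms by auto
  have "bounded (range (\<lambda>n. l0 (r1 n) / \<alpha>0 (r1 n)))"
    using \<rho>0 by (intro boundedI[of _ R]) auto
  then obtain \<rho> r2 where r2: "strict_mono r2" "((\<lambda>n. l0 (r1 n) / \<alpha>0 (r1 n)) \<circ> r2) \<longlonglongrightarrow> \<rho>"
    using bounded_imp_convergent_subsequence by blast
  define r where "r = r1 \<circ> r2"
  define u where "u n = u0 (r n)" for n
  define \<alpha> where "\<alpha> n = \<alpha>0 (r n)" for n
  define f where "f n = G (\<i> * complex_of_real (l0 (r n))) (\<alpha> n) (u n)" for n
  define q where "q n = l0 (r n) / \<alpha> n" for n
  have "r n \<ge> n" for n
    using strict_mono_imp_increasing[OF strict_mono_o[OF r1(1) r2(1)], of n] unfolding r_def .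
  then have \<alpha>: "\<bar>\<alpha> n\<bar> \<ge> real (Suc n)" for n
    using seq(1)[of "r n"] by (simp add: \<alpha>_def) (meson of_nat_le_iff order_trans add_left_mono)
  have \<alpha>1: "\<bar>\<alpha> n\<bar> \<ge> 1" "\<alpha> n \<noteq> 0" for n using \<alpha>_pos[of "r n"] by (auto simp: \<alpha>_def)
  have u: "u n \<in> Dom A \<inter> Y" "norm (u n) = 1" for n using seq by (simp_all add: u_def)
  have f: "norm (f n) \<le> 1 / \<epsilon>" for n using seq by (simp add: f_def u_def \<alpha>_def)
  have q_bnd: "\<bar>q n\<bar> \<le> R" for n using \<rho>0 by (simp add: q_def \<alpha>_def)
  have q: "q \<longlonglongrightarrow> \<rho>" using r2(2) by (simp add: q_def[abs_def] \<alpha>_def r_def o_def)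
  have ux: "u \<longlonglongrightarrow> x"
    using LIMSEQ_subseq_LIMSEQ[OF r1(2) r2(1)] by (simp add: u_def[abs_def] r_def o_def)
  have R: "R \<ge> 0" using q_bnd[of 0] by simp
  have uL: "u n \<in> Dom \<Lambda>" for n using u Dom_\<Lambda> by blast
  \<comment> \<open>The right side of \<open>Lambda_estimate\<close> grows with the frequency, but
    the frequency is at most \<open>R * \<bar>\<alpha> n\<bar>\<close>; cancelling
    \<open>\<bar>\<alpha> n\<bar>\<close> leaves a quadratic inequality for the projected
    norm.\<close>
  have QL_bnd: "norm (Q (\<Lambda> \<cdot> u n)) \<le> 1 / \<epsilon> + (R + 1) * C * (C1 / \<epsilon>)\<^sup>2 + 1" for n
  proof (rule quadratic_bound)
    let ?q = "norm (Q (\<Lambda> \<cdot> u n))" and ?l = "l0 (r n)"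
    have "\<bar>?l\<bar> = \<bar>q n\<bar> * \<bar>\<alpha> n\<bar>" using \<alpha>1(2)[of n] by (simp add: q_def abs_divide)
    also have "\<dots> \<le> R * \<bar>\<alpha> n\<bar>" by (intro mult_right_mono q_bnd) simp
    finally have l: "\<bar>?l\<bar> + 1 \<le> \<bar>\<alpha> n\<bar> * (R + 1)" using \<alpha>1(1)[of n] by (simp add: algebra_simps)
    have "\<bar>\<alpha> n\<bar> * ?q\<^sup>2 \<le> norm (f n) * ?q + (\<bar>?l\<bar> + 1) * C * E (u n)"
      using Lambda_estimate[OF u(1)[of n], of "\<alpha> n" "\<i> * complex_of_real ?l"] by (simp add: f_def norm_mult)
    also have "\<dots> \<le> \<bar>\<alpha> n\<bar> * (1 / \<epsilon>) * ?q + \<bar>\<alpha> n\<bar> * (R + 1) * C * (C1 / \<epsilon>)\<^sup>2"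
    proof (intro add_mono mult_mono mult_nonneg_nonneg l)
      show "norm (f n) \<le> \<bar>\<alpha> n\<bar> * (1 / \<epsilon>)"
        using f[of n] \<alpha>1(1)[of n] assms mult_right_mono[of 1 "\<bar>\<alpha> n\<bar>" "1 / \<epsilon>"] by simp
      show "E (u n) \<le> (C1 / \<epsilon>)\<^sup>2" using E0 by (simp add: u_def)
      show "E (u n) \<ge> 0" using E_nonneg u by blast
    qed (use R C assms in auto)
    finally have "\<bar>\<alpha> n\<bar> * ?q\<^sup>2 \<le> \<bar>\<alpha> n\<bar> * (1 / \<epsilon> * ?q + (R + 1) * C * (C1 / \<epsilon>)\<^sup>2)"
      by (simp add: algebra_simps)
    then show "?q\<^sup>2 \<le> 1 / \<epsilon> * ?q + (R + 1) * C * (C1 / \<epsilon>)\<^sup>2"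
      using \<alpha>1(1)[of n] by (simp only: mult_le_cancel_left)
  qed (use assms R C in auto)
  \<comment> \<open>Times \<open>\<i> * complex_of_real (\<alpha> n)\<close> this is
    \<open>f n + A \<cdot> u n\<close>. The energy does not bound the norm of
    \<open>A \<cdot> u n\<close>, so \<open>A\<close> is moved onto test vectors from
    \<open>Dom A\<close> and the limit is taken weakly.\<close>
  define g where "g n = Q (\<Lambda> \<cdot> u n) + q n *\<^sub>R u n" for n
  have g_weak: "(\<lambda>n. inner (g n) z) \<longlonglongrightarrow> 0" for z
  proof (rule dense_tendsto_inner_zero[OF dense_A])
    show "norm (g n) \<le> (1 / \<epsilon> + (R + 1) * C * (C1 / \<epsilon>)\<^sup>2 + 1) + R" for n
      unfolding g_def using QL_bnd[of n] q_bnd[of n] u(2)[of n]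
      by (intro norm_triangle_le add_mono) auto
    fix \<phi> assume \<phi>: "\<phi> \<in> Dom A"
    show "(\<lambda>n. inner (g n) \<phi>) \<longlonglongrightarrow> 0"
    proof (rule Lim_null_comparison)
      let ?c = "norm \<phi> / \<epsilon> + norm (A \<cdot> \<phi>)"
      show "(\<lambda>n. ?c * (1 / real (Suc n))) \<longlonglongrightarrow> 0"
        using tendsto_mult[OF tendsto_const LIMSEQ_Suc[OF lim_1_over_n], of ?c] by simp
      have "norm (inner (g n) \<phi>) \<le> ?c * (1 / real (Suc n))" for n
      proof -
        have "(\<i> * complex_of_real (\<alpha> n)) *\<^sub>C g n = f n + A \<cdot> u n"
        proof -
          have "(\<i> * complex_of_real (\<alpha> n)) *\<^sub>C (q n *\<^sub>R u n) = (\<i> * complex_of_real (l0 (r n))) *\<^sub>C u n"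
            using \<alpha>1(2)[of n] by (simp add: q_def scaleC_scaleC flip: scaleC_of_real)
          then show ?thesis by (simp add: f_def g_def G_def scaleC_add_right)
        qed
        then have "\<i> * complex_of_real (\<alpha> n) * cinner (g n) \<phi> = cinner (f n) \<phi> + cinner (u n) (A \<cdot> \<phi>)"
          using self_adjoint_sym[OF self_adjoint _ \<phi>, of "u n"] u(1)[of n]
          by (metis IntD1 cinner_add_left cinner_scaleC_left)
        then have "\<bar>\<alpha> n\<bar> * cmod (cinner (g n) \<phi>) = cmod (cinner (f n) \<phi> + cinner (u n) (A \<cdot> \<phi>))"
          by (metis norm_mult norm_ii mult_1 norm_of_real)
        also have "\<dots> \<le> norm (f n) * norm \<phi> + norm (u n) * norm (A \<cdot> \<phi>)"
          by (intro norm_triangle_le add_mono cinner_le_norm)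
        also have "\<dots> \<le> 1 / \<epsilon> * norm \<phi> + 1 * norm (A \<cdot> \<phi>)"
          using u(2)[of n] by (intro add_mono mult_right_mono f) auto
        also have "\<dots> = ?c" by simp
        finally have "\<bar>\<alpha> n\<bar> * cmod (cinner (g n) \<phi>) \<le> ?c" .
        moreover have "\<bar>inner (g n) \<phi>\<bar> \<le> cmod (cinner (g n) \<phi>)"
          using abs_Re_le_cmod by (metis Re_cinner)
        ultimately have "real (Suc n) * \<bar>inner (g n) \<phi>\<bar> \<le> ?c"
          using \<alpha>[of n] by (meson mult_mono order_trans abs_ge_zero)
        then show ?thesis by (simp add: field_simps)
      qed
      then show "\<forall>\<^sub>F n in sequentially. norm (inner (g n) \<phi>) \<le> ?c * (1 / real (Suc n))" by simp
    qed
  qed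
  \<comment> \<open>The kernel component of \<open>\<Lambda> \<cdot> u n\<close>. By
    \<open>compl_Lambda_bounded\<close> it depends boundedly on \<open>u n\<close> and so converges
    strongly.\<close>
  define w where "w n = \<Lambda> \<cdot> u n - Q (\<Lambda> \<cdot> u n)" for n
  obtain K' where K': "K' \<ge> 0" "\<And>u. u \<in> Dom \<Lambda> \<Longrightarrow> norm (\<Lambda> \<cdot> u - Q (\<Lambda> \<cdot> u)) \<le> K' * norm u"
    using compl_Lambda_bounded by blast
  have w_diff: "norm (w m - w n) \<le> K' * norm (u m - u n)" for m n
  proof -
    have "w m - w n = \<Lambda> \<cdot> (u m - u n) - Q (\<Lambda> \<cdot> (u m - u n))"
      by (simp add: w_def linear_op_diff[OF lin_\<Lambda> uL uL] Q_diff)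
    then show ?thesis using K'(2)[OF Dom_diff[OF lin_\<Lambda> uL uL]] by simp
  qed
  have "Cauchy w"
  proof (rule metric_CauchyI)
    fix e :: real assume "e > 0"
    then have "e / (K' + 1) > 0" using K'(1) by simp
    then obtain N where N: "\<forall>m\<ge>N. \<forall>n\<ge>N. dist (u m) (u n) < e / (K' + 1)"
      using metric_CauchyD[OF LIMSEQ_imp_Cauchy[OF ux]] by blast
    have "dist (w m) (w n) < e" if "m \<ge> N" "n \<ge> N" for m n
    proof -
      have "norm (w m - w n) \<le> (K' + 1) * norm (u m - u n)"
        using w_diff[of m n] by (simp add: distrib_right add_increasing2)
      also have "\<dots> < e" using N that K'(1) by (simp add: dist_norm field_simps)
      finally show ?thesis by (simp add: dist_norm)
    qed
    then show "\<exists>N. \<forall>m\<ge>N. \<forall>n\<ge>N. dist (w m) (w n) < e" by blast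
  qed
  then obtain p where p: "w \<longlonglongrightarrow> p" using Cauchy_convergent convergent_def by blast
  have "p \<in> Ker \<Lambda>" using closed_sequentially[OF N(1) _ p] Q_compl by (simp add: w_def)
  have "x \<in> Y" using closed_sequentially[OF closed_Y _ ux] u by blast
  have "norm x = 1" using LIMSEQ_unique[OF tendsto_norm[OF ux]] u(2) by simp
  \<comment> \<open>\<open>\<Lambda> \<cdot> u n\<close> splits into the weakly null
    \<open>g n\<close> and the strongly convergent \<open>w n - q n *\<^sub>R u n\<close>;
    closedness of the graph then identifies the limit equation.\<close>
  have "(\<lambda>n. inner (\<Lambda> \<cdot> u n) z) \<longlonglongrightarrow> inner (p - \<rho> *\<^sub>R x) z" for z
  proof -
    have "(\<lambda>n. inner (g n) z + inner (w n - q n *\<^sub>R u n) z) \<longlonglongrightarrow> 0 + inner (p - \<rho> *\<^sub>R x) z"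
      by (intro tendsto_add g_weak tendsto_inner tendsto_diff tendsto_scaleR p q ux tendsto_const)
    moreover have "inner (g n) z + inner (w n - q n *\<^sub>R u n) z = inner (\<Lambda> \<cdot> u n) z" for n
      by (simp add: g_def w_def inner_simps)
    ultimately show ?thesis by simp
  qed
  then have "x \<in> Dom \<Lambda>" "\<Lambda> \<cdot> x = p - \<rho> *\<^sub>R x"
    using closed_op_weak[OF lin_\<Lambda> closed_\<Lambda> uL ux] by blast+
  then have "x = 0" using no_limit_mode \<open>x \<in> Y\<close> \<open>p \<in> Ker \<Lambda>\<close> by blast
  then show False using \<open>norm x = 1\<close> by simp
qed

section \<open>The operator in the whole space\<close>

text \<open>\<Lambda> vanishes on the kernel component, which makes the block decomposition of
  \<open>L\<^sub>\<alpha>\<close> triangular.\<close>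

lemma Lambda_Q:
  assumes "u \<in> Dom A" shows "\<Lambda> \<cdot> Q u = \<Lambda> \<cdot> u"
proof -
  have "\<Lambda> \<cdot> (u - Q u) = 0" using Q_compl[of u] by (simp add: Ker_def)
  then show ?thesis using assms Q_Dom Dom_\<Lambda> by (simp add: linear_op_diff[OF lin_\<Lambda>])
qed

text \<open>First block row: the \<open>Y\<close> component solves an equation of its own.\<close>

lemma Q_L_op:
  assumes "u \<in> Dom A"
  shows "Q (\<zeta> *\<^sub>C u - L_op A \<Lambda> \<alpha> \<cdot> u) = G \<zeta> \<alpha> (Q u)"
  using assms by (simp add: L_op_def G_def Q_diff Q_scaleC Q_A Lambda_Q)

text \<open>Second block row: the kernel component solves the shifted equation for \<open>A\<close>,
  and the \<open>Y\<close> component enters only as a source.\<close>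

lemma compl_L_op:
  assumes "u \<in> Dom A"
  shows "\<zeta> *\<^sub>C (u - Q u) - A \<cdot> (u - Q u) = (\<zeta> *\<^sub>C u - L_op A \<Lambda> \<alpha> \<cdot> u)
    - Q (\<zeta> *\<^sub>C u - L_op A \<Lambda> \<alpha> \<cdot> u)
    - (\<i> * complex_of_real \<alpha>) *\<^sub>C (\<Lambda> \<cdot> Q u - Q (\<Lambda> \<cdot> Q u))"
  using assms Q_Dom
  by (simp add: L_op_def Lambda_Q Q_diff Q_scaleC Q_A linear_op_diff[OF lin_A] scaleC_diff_right)

text \<open>Forward substitution: the reduced resolvent bounds \<open>Q u\<close>,
  \<open>compl_Lambda_bounded\<close> bounds the source it generates, and
  \<open>shift_lower_bound\<close> then bounds \<open>u - Q u\<close>.\<close>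

lemma L_op_inj_bound:
  assumes res: "\<zeta> \<in> resolvent_set Y (QL_op Y A \<Lambda> \<alpha>)" and \<zeta>: "Re \<zeta> > -1"
  obtains M where "\<And>u. u \<in> Dom A \<Longrightarrow> norm u \<le> M * norm (\<zeta> *\<^sub>C u - L_op A \<Lambda> \<alpha> \<cdot> u)"
proof -
  have D: "Dom (QL_op Y A \<Lambda> \<alpha>) = Dom A \<inter> Y" by (simp add: QL_op_def)
  obtain M0 where M0: "\<And>u. u \<in> Dom A \<inter> Y \<Longrightarrow> norm u \<le> M0 * norm (G \<zeta> \<alpha> u)"
    using res unfolding resolvent_set_def D by (auto simp: QL_eq)
  obtain K' where K': "K' \<ge> 0" "\<And>u. u \<in> Dom \<Lambda> \<Longrightarrow> norm (\<Lambda> \<cdot> u - Q (\<Lambda> \<cdot> u)) \<le> K' * norm u"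
    using compl_Lambda_bounded by blast
  define M where "M = max M0 0"
  have "norm u \<le> (M + (1 + \<bar>\<alpha>\<bar> * K' * M) / (Re \<zeta> + 1)) * norm (\<zeta> *\<^sub>C u - L_op A \<Lambda> \<alpha> \<cdot> u)"
    if u: "u \<in> Dom A" for u
  proof -
    let ?f = "\<zeta> *\<^sub>C u - L_op A \<Lambda> \<alpha> \<cdot> u"
    have "norm (Q u) \<le> M0 * norm (G \<zeta> \<alpha> (Q u))" using M0 Q_Dom[OF u] Q_in by blast
    also have "\<dots> \<le> M * norm (G \<zeta> \<alpha> (Q u))" by (intro mult_right_mono) (auto simp: M_def)
    also have "\<dots> \<le> M * norm ?f"
      unfolding Q_L_op[OF u, symmetric] by (intro mult_left_mono norm_Q_le) (simp add: M_def)
    finally have Qu: "norm (Q u) \<le> M * norm ?f" .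
    have "(Re \<zeta> + 1) * norm (u - Q u) \<le> norm (\<zeta> *\<^sub>C (u - Q u) - A \<cdot> (u - Q u))"
      by (intro shift_lower_bound Dom_diff lin_A u Q_Dom)
    also have "\<dots> \<le> norm (?f - Q ?f) + norm ((\<i> * complex_of_real \<alpha>) *\<^sub>C (\<Lambda> \<cdot> Q u - Q (\<Lambda> \<cdot> Q u)))"
      unfolding compl_L_op[OF u, of \<zeta> \<alpha>] by (rule norm_triangle_ineq4)
    also have "\<dots> \<le> norm ?f + \<bar>\<alpha>\<bar> * (K' * (M * norm ?f))"
    proof (rule add_mono[OF norm_compl_le])
      have "norm (\<Lambda> \<cdot> Q u - Q (\<Lambda> \<cdot> Q u)) \<le> K' * norm (Q u)"
        using K'(2) Dom_\<Lambda> Q_Dom[OF u] by blast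
      also have "\<dots> \<le> K' * (M * norm ?f)" by (intro mult_left_mono Qu K'(1))
      finally show "norm ((\<i> * complex_of_real \<alpha>) *\<^sub>C (\<Lambda> \<cdot> Q u - Q (\<Lambda> \<cdot> Q u))) \<le> \<bar>\<alpha>\<bar> * (K' * (M * norm ?f))"
        by (simp add: norm_scaleC norm_mult mult_left_mono)
    qed
    finally have "norm (u - Q u) \<le> (1 + \<bar>\<alpha>\<bar> * K' * M) / (Re \<zeta> + 1) * norm ?f"
      using \<zeta> by (simp add: field_simps)
    moreover have "norm u \<le> norm (Q u) + norm (u - Q u)"
      using norm_triangle_ineq[of "Q u" "u - Q u"] by simp
    ultimately show ?thesis using Qu by (simp add: distrib_right)
  qed
  then show ?thesis using that by blast
qed

text \<open>The same substitution constructs the solution: \<open>v\<close> solves the reduced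
  equation and \<open>w\<close> corrects the kernel component.\<close>

lemma L_op_surj:
  assumes res: "\<zeta> \<in> resolvent_set Y (QL_op Y A \<Lambda> \<alpha>)" and \<zeta>: "Re \<zeta> > -1"
  shows "\<exists>u\<in>Dom A. \<zeta> *\<^sub>C u - L_op A \<Lambda> \<alpha> \<cdot> u = f"
proof -
  have D: "Dom (QL_op Y A \<Lambda> \<alpha>) = Dom A \<inter> Y" by (simp add: QL_op_def)
  have "(\<lambda>u. \<zeta> *\<^sub>C u - QL_op Y A \<Lambda> \<alpha> \<cdot> u) ` (Dom A \<inter> Y) = Y"
    using res unfolding resolvent_set_def D bij_betw_def by blast
  with Q_in[of f] have "Q f \<in> (\<lambda>u. \<zeta> *\<^sub>C u - QL_op Y A \<Lambda> \<alpha> \<cdot> u) ` (Dom A \<inter> Y)" by (simp only:)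
  then obtain v where v: "v \<in> Dom A \<inter> Y" "\<zeta> *\<^sub>C v - QL_op Y A \<Lambda> \<alpha> \<cdot> v = Q f"
    unfolding image_iff by (elim bexE) simp
  then have Gv: "G \<zeta> \<alpha> v = Q f" by (simp add: QL_eq)
  define h where "h = (f - Q f) - (\<i> * complex_of_real \<alpha>) *\<^sub>C (\<Lambda> \<cdot> v - Q (\<Lambda> \<cdot> v))"
  obtain w where w: "w \<in> Dom A" "\<zeta> *\<^sub>C w - A \<cdot> w = h" using shift_surj[OF \<zeta>] by blast
  \<comment> \<open>The correction adds no new coupling: its source has no \<open>Y\<close>
    component, so by injectivity of the shift \<open>w\<close> has none either, and \<Lambda>
    annihilates it.\<close>
  have "Q h = 0" by (simp add: h_def Q_diff Q_scaleC Q_id[OF Q_in])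
  then have "\<zeta> *\<^sub>C Q w - A \<cdot> Q w = 0"
    using w by (auto simp: Q_A Q_diff Q_scaleC)
  then have "(Re \<zeta> + 1) * norm (Q w) \<le> 0" using shift_lower_bound[OF Q_Dom[OF w(1)], of \<zeta>] by simp
  then have "Q w = 0" using \<zeta> by (simp add: mult_le_0_iff)
  then have "\<Lambda> \<cdot> w = 0"
    using Lambda_Q[OF w(1)] linear_op_zero[OF lin_\<Lambda>] by simp
  then have "\<zeta> *\<^sub>C (v + w) - L_op A \<Lambda> \<alpha> \<cdot> (v + w)
      = (\<zeta> *\<^sub>C v - A \<cdot> v + (\<i> * complex_of_real \<alpha>) *\<^sub>C (\<Lambda> \<cdot> v)) + h"
    using v(1) w Dom_\<Lambda>
    by (auto simp: L_op_def linear_op_add[OF lin_A] linear_op_add[OF lin_\<Lambda>] scaleC_add_right)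
  also have "\<dots> = G \<zeta> \<alpha> v + (f - Q f)" by (simp add: h_def G_def scaleC_diff_right)
  also have "\<dots> = f" by (simp add: Gv)
  finally show ?thesis using v(1) w(1) Dom_add[OF lin_A] by blast
qed

lemma L_op_resolvent_set:
  assumes res: "\<zeta> \<in> resolvent_set Y (QL_op Y A \<Lambda> \<alpha>)" and \<zeta>: "Re \<zeta> > -1"
  shows "\<zeta> \<in> resolvent_set UNIV (L_op A \<Lambda> \<alpha>)"
proof -
  obtain M where M: "\<And>u. u \<in> Dom A \<Longrightarrow> norm u \<le> M * norm (\<zeta> *\<^sub>C u - L_op A \<Lambda> \<alpha> \<cdot> u)"
    using L_op_inj_bound[OF assms] by blast
  have "inj_on (\<lambda>u. \<zeta> *\<^sub>C u - L_op A \<Lambda> \<alpha> \<cdot> u) (Dom A)"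
  proof (rule inj_onI)
    fix u v assume uv: "u \<in> Dom A" "v \<in> Dom A"
      "\<zeta> *\<^sub>C u - L_op A \<Lambda> \<alpha> \<cdot> u = \<zeta> *\<^sub>C v - L_op A \<Lambda> \<alpha> \<cdot> v"
    have "\<zeta> *\<^sub>C (u - v) - L_op A \<Lambda> \<alpha> \<cdot> (u - v)
        = (\<zeta> *\<^sub>C u - L_op A \<Lambda> \<alpha> \<cdot> u) - (\<zeta> *\<^sub>C v - L_op A \<Lambda> \<alpha> \<cdot> v)"
      using uv(1,2) Dom_\<Lambda>
      by (simp add: L_op_def linear_op_diff[OF lin_A] linear_op_diff[OF lin_\<Lambda>] scaleC_diff_right)
    then show "u = v" using M[OF Dom_diff[OF lin_A uv(1,2)]] uv(3) by simp
  qed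
  moreover have "Dom (L_op A \<Lambda> \<alpha>) = Dom A" by (simp add: L_op_def)
  ultimately show ?thesis
    using M L_op_surj[OF assms] unfolding resolvent_set_def bij_betw_def by (auto simp: image_iff) metis
qed

section \<open>Operator norms of the resolvents and limits in \<alpha>\<close>

lemma resolvent_QL_bound:
  assumes est: "\<And>u. u \<in> Dom A \<inter> Y \<Longrightarrow> norm u \<le> \<epsilon> * norm (G \<zeta> \<alpha> u)" "\<epsilon> \<ge> 0"
    and res: "\<zeta> \<in> resolvent_set Y (QL_op Y A \<Lambda> \<alpha>)"
  shows "opnorm_on Y (resolvent (QL_op Y A \<Lambda> \<alpha>) \<zeta>) \<le> ereal \<epsilon>"
  unfolding opnorm_on_def
proof (rule SUP_least)
  fix v assume v: "v \<in> {v \<in> Y. norm v \<le> 1}"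
  have D: "Dom (QL_op Y A \<Lambda> \<alpha>) = Dom A \<inter> Y" by (simp add: QL_op_def)
  let ?u = "resolvent (QL_op Y A \<Lambda> \<alpha>) \<zeta> v"
  have "v \<in> (\<lambda>u. \<zeta> *\<^sub>C u - QL_op Y A \<Lambda> \<alpha> \<cdot> u) ` (Dom A \<inter> Y)"
    using res v unfolding resolvent_set_def D bij_betw_def by blast
  then have u: "?u \<in> Dom A \<inter> Y" "\<zeta> *\<^sub>C ?u - QL_op Y A \<Lambda> \<alpha> \<cdot> ?u = v"
    unfolding resolvent_def D by (rule inv_into_into, rule f_inv_into_f)
  have "norm ?u \<le> \<epsilon> * norm v" using est(1)[OF u(1)] u by (simp add: QL_eq)
  also have "\<dots> \<le> \<epsilon> * 1" using v est(2) by (intro mult_left_mono) auto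
  finally show "ereal (norm ?u) \<le> ereal \<epsilon>" by simp
qed

text \<open>By \<open>Q_L_op\<close> the projected solution solves the reduced equation with the
  projected source, so the constant is that of the estimate in \<open>Y\<close>.\<close>

lemma resolvent_L_bound:
  assumes est: "\<And>u. u \<in> Dom A \<inter> Y \<Longrightarrow> norm u \<le> \<epsilon> * norm (G \<zeta> \<alpha> u)" "\<epsilon> \<ge> 0"
    and res: "\<zeta> \<in> resolvent_set UNIV (L_op A \<Lambda> \<alpha>)"
  shows "opnorm_on UNIV (\<lambda>v. Q (resolvent (L_op A \<Lambda> \<alpha>) \<zeta> v)) \<le> ereal \<epsilon>"
  unfolding opnorm_on_def
proof (rule SUP_least)
  fix v :: 'a assume v: "v \<in> {v \<in> UNIV. norm v \<le> 1}"
  have D: "Dom (L_op A \<Lambda> \<alpha>) = Dom A" by (simp add: L_op_def)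
  let ?u = "resolvent (L_op A \<Lambda> \<alpha>) \<zeta> v"
  have "v \<in> (\<lambda>u. \<zeta> *\<^sub>C u - L_op A \<Lambda> \<alpha> \<cdot> u) ` Dom A"
    using res unfolding resolvent_set_def D bij_betw_def by blast
  then have u: "?u \<in> Dom A" "\<zeta> *\<^sub>C ?u - L_op A \<Lambda> \<alpha> \<cdot> ?u = v"
    unfolding resolvent_def D by (rule inv_into_into, rule f_inv_into_f)
  have "norm (Q ?u) \<le> \<epsilon> * norm (G \<zeta> \<alpha> (Q ?u))" using est(1) Q_Dom[OF u(1)] Q_in by blast
  also have "\<dots> \<le> \<epsilon> * norm v"
    using norm_Q_le est(2) by (simp flip: Q_L_op[OF u(1)] add: u(2) mult_left_mono)
  also have "\<dots> \<le> \<epsilon> * 1" using v est(2) by (intro mult_left_mono) auto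
  finally show "ereal (norm (Q ?u)) \<le> ereal \<epsilon>" by simp
qed

end

lemma opnorm_on_nonneg: "0 \<in> Y \<Longrightarrow> 0 \<le> opnorm_on Y R"
  unfolding opnorm_on_def by (rule SUP_upper2[of 0]) auto

text \<open>The supremum is nonnegative because the zero vector enters each norm; the bound uniform
  in \<open>l\<close> handles the other side.\<close>

lemma SUP_opnorm_tendsto_zero:
  fixes R :: "real \<Rightarrow> real \<Rightarrow> 'a::chilbert_space \<Rightarrow> 'a"
  assumes "0 \<in> Y"
    and bound: "\<And>\<epsilon>. \<epsilon> > 0 \<Longrightarrow> \<forall>\<^sub>F \<alpha> in F. \<forall>l. opnorm_on Y (R \<alpha> l) \<le> ereal \<epsilon>"
  shows "((\<lambda>\<alpha>. SUP l. opnorm_on Y (R \<alpha> l)) \<longlongrightarrow> 0) F"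
proof (rule order_tendstoI)
  fix a :: ereal assume "a < 0"
  have "0 \<le> (SUP l. opnorm_on Y (R \<alpha> l))" for \<alpha>
    by (rule SUP_upper2[of 0]) (simp_all add: opnorm_on_nonneg assms(1))
  then show "\<forall>\<^sub>F \<alpha> in F. a < (SUP l. opnorm_on Y (R \<alpha> l))"
    using \<open>a < 0\<close> by (intro always_eventually allI) (rule less_le_trans)
next
  fix a :: ereal assume "0 < a"
  then obtain \<epsilon> where \<epsilon>: "0 < ereal \<epsilon>" "ereal \<epsilon> < a" using ereal_dense2 by blast
  then have "\<epsilon> > 0" by simp
  from bound[OF this] show "\<forall>\<^sub>F \<alpha> in F. (SUP l. opnorm_on Y (R \<alpha> l)) < a"
  proof eventually_elim
    case (elim \<alpha>)
    then have "(SUP l. opnorm_on Y (R \<alpha> l)) \<le> ereal \<epsilon>" by (intro SUP_least) blast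
    then show ?case using \<epsilon>(2) by (rule le_less_trans)
  qed
qed

context pseudospectral_setting
begin

lemma eventually_decay:
  assumes "\<epsilon> > 0"
  shows "\<forall>\<^sub>F \<alpha> in at_infinity. \<forall>l. \<forall>u\<in>Dom A \<inter> Y. norm u \<le> \<epsilon> * norm (G (\<i> * complex_of_real l) \<alpha> u)"
  using decay_estimate[OF assms] by (simp add: eventually_at_infinity)

lemma eventually_resolvent_set:
  "\<forall>\<^sub>F \<alpha> in at_infinity. \<forall>\<zeta>. Re \<zeta> \<ge> - M \<longrightarrow> \<zeta> \<in> resolvent_set Y (QL_op Y A \<Lambda> \<alpha>)"
proof -
  \<comment> \<open>Gives \<open>\<epsilon> * M \<le> 1 / 2\<close> for either sign of
    \<open>M\<close>, as \<open>left_strip\<close> asks.\<close>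
  define \<epsilon> where "\<epsilon> = 1 / (2 * (\<bar>M\<bar> + 1))"
  have \<epsilon>: "\<epsilon> > 0" "\<epsilon> * M \<le> 1 / 2" by (simp_all add: \<epsilon>_def field_simps)
  show ?thesis
    using eventually_decay[OF \<epsilon>(1)]
  proof eventually_elim
    case (elim \<alpha>)
    show ?case using left_strip[OF _ less_imp_le[OF \<epsilon>(1)] \<epsilon>(2)] elim by blast
  qed
qed

lemma spectral_abscissa_tendsto:
  "((\<lambda>\<alpha>. SUP \<mu>\<in>spectrum Y (QL_op Y A \<Lambda> \<alpha>). ereal (Re \<mu>)) \<longlongrightarrow> -\<infinity>) at_infinity"
  unfolding tendsto_MInfty
proof
  fix r :: real
  \<comment> \<open>With \<open>M = 1 - r\<close> the spectrum lies in
    \<open>Re \<mu> < r - 1\<close>; the spare unit keeps the supremum strictly below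
    \<open>r\<close>. An empty spectrum has supremum \<open>-\<infinity>\<close> and is
    covered.\<close>
  show "\<forall>\<^sub>F \<alpha> in at_infinity. (SUP \<mu>\<in>spectrum Y (QL_op Y A \<Lambda> \<alpha>). ereal (Re \<mu>)) < ereal r"
    using eventually_resolvent_set[of "1 - r"]
  proof eventually_elim
    case (elim \<alpha>)
    then have "(SUP \<mu>\<in>spectrum Y (QL_op Y A \<Lambda> \<alpha>). ereal (Re \<mu>)) \<le> ereal (r - 1)"
      by (intro SUP_least) (force simp: spectrum_def)
    then show ?case by (rule le_less_trans) simp
  qed
qed

lemma resolvent_QL_tendsto:
  "((\<lambda>\<alpha>. SUP l. opnorm_on Y (resolvent (QL_op Y A \<Lambda> \<alpha>) (\<i> * complex_of_real l))) \<longlongrightarrow> 0) at_infinity"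
proof (rule SUP_opnorm_tendsto_zero)
  show "0 \<in> Y" using csubspace_Y by (simp add: csubspace_def)
  fix \<epsilon> :: real assume "\<epsilon> > 0"
  from eventually_decay[OF this]
  show "\<forall>\<^sub>F \<alpha> in at_infinity. \<forall>l. opnorm_on Y (resolvent (QL_op Y A \<Lambda> \<alpha>) (\<i> * complex_of_real l)) \<le> ereal \<epsilon>"
    by eventually_elim (use \<open>\<epsilon> > 0\<close> in \<open>auto intro!: resolvent_QL_bound right_half_plane\<close>)
qed

lemma eventually_L_op_resolvent_set:
  "\<forall>\<^sub>F \<alpha> in at_infinity. {\<zeta>. Re \<zeta> > -1} \<subseteq> resolvent_set UNIV (L_op A \<Lambda> \<alpha>)"
  using eventually_resolvent_set[of 1] by eventually_elim (auto intro: L_op_resolvent_set)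

lemma resolvent_L_tendsto:
  "((\<lambda>\<alpha>. SUP l. opnorm_on UNIV (\<lambda>v. Q (resolvent (L_op A \<Lambda> \<alpha>) (\<i> * complex_of_real l) v))) \<longlongrightarrow> 0) at_infinity"
proof (rule SUP_opnorm_tendsto_zero)
  fix \<epsilon> :: real assume "\<epsilon> > 0"
  from eventually_decay[OF this] eventually_L_op_resolvent_set
  show "\<forall>\<^sub>F \<alpha> in at_infinity. \<forall>l.
      opnorm_on UNIV (\<lambda>v. Q (resolvent (L_op A \<Lambda> \<alpha>) (\<i> * complex_of_real l) v)) \<le> ereal \<epsilon>"
    by eventually_elim (use \<open>\<epsilon> > 0\<close> in \<open>auto intro!: resolvent_L_bound\<close>)
qed simp

end

section \<open>Verification of the abstract setting from the hypotheses\<close>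

lemma symmetric_real: "symmetric_op T \<Longrightarrow> u \<in> Dom T \<Longrightarrow> Im (cinner (T \<cdot> u) u) = 0"
  unfolding symmetric_op_def using cinner_commute[of u "T \<cdot> u"] by (simp add: complex_eq_iff)

text \<open>Relative compactness bounds \<open>T\<close> on the unit ball of the graph norm, and
  \<open>norm u \<le> norm (A \<cdot> u)\<close> makes the graph norm at most twice
  \<open>norm (A \<cdot> u)\<close>; scaling does the rest.\<close>

lemma (in coercive_operator) relatively_compact_bound:
  assumes "linear_op T" "relatively_compact T (op_neg A)"
  obtains K where "K > 0" "\<And>u. u \<in> Dom A \<Longrightarrow> norm (T \<cdot> u) \<le> K * norm (A \<cdot> u)"
proof -
  let ?S = "(\<lambda>u. T \<cdot> u) ` {u \<in> Dom (op_neg A). graph_norm (op_neg A) u \<le> 1}"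
  have DT: "Dom A \<subseteq> Dom T" and "compact (closure ?S)"
    using assms(2) by (auto simp: relatively_compact_def op_neg_def)
  then have "bounded ?S" using bounded_subset[OF compact_imp_bounded closure_subset] by blast
  then obtain M where M: "M > 0" "\<And>u. u \<in> Dom A \<Longrightarrow> norm u + norm (A \<cdot> u) \<le> 1 \<Longrightarrow> norm (T \<cdot> u) \<le> M"
    unfolding bounded_pos by (force simp: op_neg_def graph_norm_def)
  have "norm (T \<cdot> u) \<le> 2 * M * norm (A \<cdot> u)" if u: "u \<in> Dom A" for u
  proof (cases "u = 0")
    case True
    then show ?thesis using linear_op_zero[OF assms(1)] M(1) by simp
  next
    case False
    have le: "norm u \<le> norm (A \<cdot> u)" using shift_lower_bound[OF u, of 0] by simp
    then have pos: "norm (A \<cdot> u) > 0" using False by (metis norm_le_zero_iff not_le order_trans)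
    define s where "s = 1 / (2 * norm (A \<cdot> u))"
    have s: "s > 0" using pos by (simp add: s_def)
    have "norm (s *\<^sub>R u) + norm (A \<cdot> (s *\<^sub>R u)) = s * (norm u + norm (A \<cdot> u))"
      using s by (simp add: linear_op_scaleR[OF lin_A u] distrib_left)
    also have "\<dots> \<le> s * (2 * norm (A \<cdot> u))" using le s by (intro mult_left_mono) auto
    also have "\<dots> = 1" using pos by (simp add: s_def)
    finally have "norm (T \<cdot> (s *\<^sub>R u)) \<le> M" by (intro M(2) Dom_scaleR lin_A u)
    moreover have "T \<cdot> (s *\<^sub>R u) = s *\<^sub>R (T \<cdot> u)" using linear_op_scaleR[OF assms(1)] DT u by blast
    ultimately have "s * norm (T \<cdot> u) \<le> M" using s by simp
    then show ?thesis using pos by (simp add: s_def field_simps)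
  qed
  then show ?thesis using that[of "2 * M"] M(1) by simp
qed

theorem theorem2p4:
  fixes A \<Lambda> :: "'a::chilbert_space operator"
    and Y :: "'a set" and Q :: "'a \<Rightarrow> 'a"
  assumes lin: "linear_op A" "linear_op \<Lambda>"
    and Y: "Y = orth_complement (Ker \<Lambda>)"
    and Q: "Q = orth_proj Y"
    and A1: "self_adjoint_op A" "compact_resolvent A"
      "\<forall>u\<in>Dom A. Re (cinner (- (A \<cdot> u)) u) \<ge> (norm u)\<^sup>2"
    and A2i: "densely_defined \<Lambda>" "closed_op \<Lambda>" "relatively_compact \<Lambda> (op_neg A)"
    and A2ii: "\<forall>u\<in>Dom A. Q u \<in> Dom A \<and> A \<cdot> (Q u) = Q (A \<cdot> u)"
      "Dom A \<subseteq> Dom (adjoint_op \<Lambda>)"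
      "\<exists>C>0. \<forall>u\<in>Dom A.
         cmod (cinner (\<Lambda> \<cdot> u) u) + \<bar>Im (cinner (- (A \<cdot> u)) (\<Lambda> \<cdot> u))\<bar>
           \<le> C * Re (cinner (- (A \<cdot> u)) u)"
    and A2iii: "\<exists>B1 B2 :: 'a operator. \<exists>c1>0. \<exists>C>0.
         closed_op B1 \<and> symmetric_op B1 \<and> closed_op B2 \<and> symmetric_op B2 \<and>
         op_eq \<Lambda> (op_comp B1 B2) \<and> Ker \<Lambda> = Ker B2 \<and> Dom A \<subseteq> Dom B2 \<and>
         (\<forall>u\<in>Dom A. (norm (B2 \<cdot> u))\<^sup>2 \<le> C * (norm (op_sqrt (op_neg A) \<cdot> u))\<^sup>2) \<and>
         (\<forall>u\<in>Dom A \<inter> Y. Re (cinner u (B2 \<cdot> u)) \<ge> c1 * (norm u)\<^sup>2) \<and>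
         (\<forall>u\<in>Dom A \<inter> Y. Re (cinner (- (A \<cdot> u)) (B2 \<cdot> u))
            \<ge> c1 * (norm (op_sqrt (op_neg A) \<cdot> u))\<^sup>2)"
    and A3: "Ker \<Lambda> \<subseteq> Dom (adjoint_op \<Lambda>)"
      "Ker \<Lambda> \<inter> Ran \<Lambda> = {0}"
      "\<forall>r::real. r \<noteq> 0 \<longrightarrow> \<not> eigenvalue \<Lambda> (complex_of_real r)"
  shows
    "((\<lambda>\<alpha>::real. SUP \<mu>\<in>spectrum Y (QL_op Y A \<Lambda> \<alpha>). ereal (Re \<mu>)) \<longlongrightarrow> -\<infinity>) at_infinity
     \<and> (\<forall>\<^sub>F \<alpha> in at_infinity. \<forall>l::real.
          \<i> * complex_of_real l \<in> resolvent_set Y (QL_op Y A \<Lambda> \<alpha>))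
     \<and> ((\<lambda>\<alpha>::real. SUP l::real.
          opnorm_on Y (resolvent (QL_op Y A \<Lambda> \<alpha>) (\<i> * complex_of_real l))) \<longlongrightarrow> 0) at_infinity
     \<and> (\<forall>\<^sub>F \<alpha> in at_infinity. {\<zeta>. Re \<zeta> > -1} \<subseteq> resolvent_set UNIV (L_op A \<Lambda> \<alpha>))
     \<and> ((\<lambda>\<alpha>::real. SUP l::real.
          opnorm_on UNIV (\<lambda>v. Q (resolvent (L_op A \<Lambda> \<alpha>) (\<i> * complex_of_real l) v)))
            \<longlongrightarrow> 0) at_infinity"
proof -
  interpret coercive_operator A
    by standard (use A1 in \<open>simp_all add: Re_cinner\<close>)
  obtain K where K: "K > 0" "\<And>u. u \<in> Dom A \<Longrightarrow> norm (\<Lambda> \<cdot> u) \<le> K * norm (A \<cdot> u)"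
    using relatively_compact_bound[OF lin(2) A2i(3)] by blast
  obtain C where C: "C > 0" "\<And>u. u \<in> Dom A \<Longrightarrow>
      cmod (cinner (\<Lambda> \<cdot> u) u) + \<bar>Im (cinner (- (A \<cdot> u)) (\<Lambda> \<cdot> u))\<bar> \<le> C * inner (- (A \<cdot> u)) u"
    using A2ii(3) unfolding Re_cinner by blast
  obtain B1 B2 c D where c: "c > 0" and D: "D > 0"
    and sym: "symmetric_op B1" "symmetric_op B2"
    and fact: "op_eq \<Lambda> (op_comp B1 B2)" and ker: "Ker \<Lambda> = Ker B2" and dom: "Dom A \<subseteq> Dom B2"
    and bound: "\<And>u. u \<in> Dom A \<Longrightarrow> (norm (B2 \<cdot> u))\<^sup>2 \<le> D * (norm (op_sqrt (op_neg A) \<cdot> u))\<^sup>2"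
    and pos: "\<And>u. u \<in> Dom A \<inter> Y \<Longrightarrow> c * (norm u)\<^sup>2 \<le> inner u (B2 \<cdot> u)"
    and coer: "\<And>u. u \<in> Dom A \<inter> Y \<Longrightarrow>
      c * (norm (op_sqrt (op_neg A) \<cdot> u))\<^sup>2 \<le> inner (- (A \<cdot> u)) (B2 \<cdot> u)"
    using A2iii unfolding Re_cinner by (elim exE conjE) blast
  \<comment> \<open>The hypotheses on \<open>B2\<close> use the square root of \<open>- A\<close>,
    the abstract setting uses the form; both agree on \<open>Dom A\<close>, whichever root
    \<open>op_sqrt\<close> selects.\<close>
  have sqrt: "(norm (op_sqrt (op_neg A) \<cdot> u))\<^sup>2 = inner (- (A \<cdot> u)) u" if "u \<in> Dom A" for u
    using norm_neg_sqrt[OF that] by (simp only: neg_sqrt_def)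
  interpret pseudospectral_setting A \<Lambda> Y "\<lambda>u. B2 \<cdot> u" K C c D
  proof
    show "closed (Ker \<Lambda>)" by (rule closed_Ker[OF A2i(2)])
    show "csubspace (Ker \<Lambda>)" by (rule csubspace_Ker[OF lin(2)])
    show "Y = orth_complement (Ker \<Lambda>)" by (rule Y)
    show "linear_op \<Lambda>" "closed_op \<Lambda>" by (rule lin A2i)+
    show "orth_proj Y u \<in> Dom A" "A \<cdot> orth_proj Y u = orth_proj Y (A \<cdot> u)" if "u \<in> Dom A" for u
      using A2ii(1) that unfolding Q by blast+
    show "u \<in> Dom \<Lambda>" if "u \<in> Dom A" for u
      using A2i(3) that by (auto simp: relatively_compact_def op_neg_def)
    show "norm (\<Lambda> \<cdot> u) \<le> K * norm (A \<cdot> u)" if "u \<in> Dom A" for u by (rule K(2)[OF that])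
    show "K > 0" "C > 0" "D > 0" "c > 0" by (rule K C D c)+
    show "cmod (cinner (\<Lambda> \<cdot> u) u) + \<bar>Im (cinner (- (A \<cdot> u)) (\<Lambda> \<cdot> u))\<bar> \<le> C * inner (- (A \<cdot> u)) u"
      if "u \<in> Dom A" for u by (rule C(2)[OF that])
    \<comment> \<open>The range of the symmetric \<open>B2\<close> is orthogonal to its kernel,
      which is \<open>Ker \<Lambda>\<close>.\<close>
    show "B2 \<cdot> u \<in> Y" if "u \<in> Dom A \<inter> Y" for u
      unfolding Y orth_complement_def ker
      using sym(2) that dom by (auto simp: symmetric_op_def Ker_def)
    show "Im (cinner u (B2 \<cdot> u)) = 0" if "u \<in> Dom A" for u
      using symmetric_real[OF sym(2), of u] dom that cinner_commute[of u "B2 \<cdot> u"] by auto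
    \<comment> \<open>By the factorization this is the form of the symmetric \<open>B1\<close> at
      \<open>B2 \<cdot> u\<close>, hence real.\<close>
    show "Im (cinner (\<Lambda> \<cdot> u) (B2 \<cdot> u)) = 0" if "u \<in> Dom A" for u
    proof -
      have "u \<in> Dom \<Lambda>" using A2i(3) that by (auto simp: relatively_compact_def op_neg_def)
      then have "B2 \<cdot> u \<in> Dom B1" "\<Lambda> \<cdot> u = B1 \<cdot> (B2 \<cdot> u)"
        using fact by (auto simp: op_eq_def op_comp_def)
      then show ?thesis using symmetric_real[OF sym(1)] by simp
    qed
    show "(norm (B2 \<cdot> u))\<^sup>2 \<le> D * inner (- (A \<cdot> u)) u" if "u \<in> Dom A" for u
      using bound[OF that] unfolding sqrt[OF that] .
    show "0 \<le> inner u (B2 \<cdot> u)" if "u \<in> Dom A \<inter> Y" for u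
      by (rule order_trans[OF _ pos[OF that]]) (use c in simp)
    show "c * inner (- (A \<cdot> u)) u \<le> inner (- (A \<cdot> u)) (B2 \<cdot> u)" if "u \<in> Dom A \<inter> Y" for u
      using coer[OF that] sqrt that by simp
    show "compact_resolvent A" "Ker \<Lambda> \<subseteq> Dom (adjoint_op \<Lambda>)" "Ker \<Lambda> \<inter> Ran \<Lambda> = {0}"
      by (rule A1 A3)+
    show "\<not> eigenvalue \<Lambda> (complex_of_real r)" if "r \<noteq> 0" for r using A3(3) that by blast
  qed
  show ?thesis
    unfolding Q
    by (intro conjI always_eventually allI spectral_abscissa_tendsto right_half_plane
        resolvent_QL_tendsto eventually_L_op_resolvent_set resolvent_L_tendsto) simp
qed

end
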